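(* Let $\alpha_1,\alpha_2,\beta_1,\beta_2,\gamma\in\widehat{\mathbb{F}_q^\times}$. (i) Suppose $\varepsilon\notin\{\alpha_1,\alpha_2,\beta_2,\overline{\beta_1\beta_2}\gamma\}$. Then for every $\lambda\in\mathbb{F}_q$, $$F_3\!\left({\alpha_1,\alpha_2;\beta_1,\beta_2\atop\gamma};\lambda,1\right)=\frac{g^\circ(\gamma)g(\overline{\alpha_2\beta_2}\gamma)}{g^\circ(\overline{\alpha_2}\gamma)g^\circ(\overline{\beta_2}\gamma)}\,{}_3F_2\!\left({\alpha_1,\beta_1,\overline{\alpha_2\beta_2}\gamma\atop\overline{\alpha_2}\gamma,\overline{\beta_2}\gamma};\lambda\right).$$ (ii) Suppose $\varepsilon\notin\{\alpha_1,\alpha_2,\beta_1,\beta_2,\overline{\alpha_1\alpha_2}\gamma\}$. Then for $\lambda\in\mathbb{F}_q$, $\lambda\neq1$, $$F_3\!\left({\alpha_1,\alpha_2;\beta_1,\beta_2\atop\gamma};\lambda,\frac{\lambda}{\lambda-1}\right)=\frac{g(\alpha_1\alpha_2\overline{\gamma})g(\alpha_2\beta_1\overline{\gamma})g(\overline{\beta_2})}{g(\overline{\gamma})g^\circ(\alpha_1\alpha_2\beta_1\overline{\gamma})g^\circ(\alpha_2\overline{\beta_2})}\,\overline{\gamma}(\lambda)\alpha_2(1-\lambda)\,{}_3F_2\!\left({\alpha_1\alpha_2\overline{\gamma},\alpha_2\beta_1\overline{\gamma},\overline{\beta_2}\atop\alpha_1\alpha_2\beta_1\overline{\gamma},\alpha_2\overline{\beta_2}};1-\lambda\right).$$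 (iii) Suppose $p\neq2$, $\varepsilon\notin\{\beta_1^2,\beta_2^2\}$ and $(\beta_1\beta_2)^2,(\beta_1\overline{\beta_2})^2\notin\{\gamma^2,\overline{\gamma}^2\}$. Then for $\lambda\in\mathbb{F}_q$, $\lambda\neq\pm1$, $$F_3\!\left({\beta_1^2,\beta_2^2;\overline{\beta_1}^2,\overline{\beta_2}^2\atop\gamma^2};\frac{\lambda}{\lambda+1},\frac{\lambda}{\lambda-1}\right)=\overline{\beta_2^2\gamma^2}(1+\lambda)\,\beta_2^2(1-\lambda)\sum_{\gamma'\in\{\gamma,\gamma\phi\}}{}_2F_1\!\left({\overline{\beta_1}\beta_2\gamma',\beta_1\beta_2\gamma'\phi\atop\gamma^2};\frac{4\lambda}{(\lambda+1)^2}\right).$$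
   Context: $\mathbb{F}_q$ is a finite field with $q$ elements and characteristic $p$. $\widehat{\mathbb{F}_q^\times}$ is the group of multiplicative characters $\mathbb{F}_q^\times\to\overline{\mathbb{Q}}^\times$, $\varepsilon$ the trivial character, $\phi$ the quadratic character (only when $p\ne 2$); every character (including $\varepsilon$) is extended by $0$ at $0$; $\overline{\eta}=\eta^{-1}$, and $\overline{\eta_1\eta_2}=(\eta_1\eta_2)^{-1}$; $\delta(\eta)=1$ if $\eta=\varepsilon$, else $0$. $\psi$ is a fixed non-trivial additive character. $g(\eta)=-\sum_{x\in\mathbb{F}_q^\times}\psi(x)\eta(x)$, $g^\circ(\eta)=q^{\delta(\eta)}g(\eta)$, $(\alpha)_\nu=g(\alpha\nu)/g(\alpha)$, $(\alpha)^\circ_\nu=g^\circ(\alpha\nu)/g^\circ(\alpha)$. For $\lambda\in\mathbb{F}_q$, ${}_mF_n\!\left({\alpha_1,\dots,\alpha_m\atop\beta_1,\dots,\beta_n};\lambda\right)=\frac{1}{1-q}\sum_{\nu}\frac{\prod_i(\alpha_i)_\nu}{(\varepsilon)^\circ_\nu\prod_j(\beta_j)^\circ_\nu}\nu(\lambda)$; Appell's function: for $x,y\in\mathbb{F}_q$, $F_3\!\left({\alpha_1,\alpha_2;\beta_1,\beta_2\atop\gamma};x,y\right)=\frac{1}{(1-q)^2}\sum_{\nu_1,\nu_2}\frac{(\alpha_1)_{\nu_1}(\alpha_2)_{\nu_2}(\beta_1)_{\nu_1}(\beta_2)_{\nu_2}}{(\gamma)^\circ_{\nu_1\nu_2}(\varepsilon)^\circ_{\nu_1}(\varepsilon)^\circ_{\nu_2}}\nu_1(x)\nu_2(y)$,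 sums over characters. *)

theory Defs
  imports Complex_Main
begin

text \<open>Finite field F_q = a type of sort {finite, field}; characters take values in complex
numbers (containing the algebraic closure of Q). All characters are extended by 0 at 0.\<close>

definition mchar :: "('a::{finite,field} \<Rightarrow> complex) \<Rightarrow> bool" where
  "mchar \<chi> \<longleftrightarrow> \<chi> 0 = 0 \<and> (\<forall>x. x \<noteq> 0 \<longrightarrow> \<chi> x \<noteq> 0) \<and>
     (\<forall>x y. x \<noteq> 0 \<longrightarrow> y \<noteq> 0 \<longrightarrow> \<chi> (x * y) = \<chi> x * \<chi> y)"

definition mchars :: "('a::{finite,field} \<Rightarrow> complex) set" where
  "mchars = {\<chi>. mchar \<chi>}"

definition addchar :: "('a::{finite,field} \<Rightarrow> complex) \<Rightarrow> bool" where
  "addchar \<psi> \<longleftrightarrow> \<psi> 0 = 1 \<and> (\<forall>x y. \<psi> (x + y) = \<psi> x * \<psi> y)"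

definition eps :: "'a::{finite,field} \<Rightarrow> complex" where
  "eps x = (if x = 0 then 0 else 1)"

definition qchar :: "'a::{finite,field} \<Rightarrow> complex" where
  "qchar x = (if x = 0 then 0 else if (\<exists>y. y ^ 2 = x) then 1 else -1)"

definition cmul :: "('a::{finite,field} \<Rightarrow> complex) \<Rightarrow> ('a \<Rightarrow> complex) \<Rightarrow> 'a \<Rightarrow> complex" where
  "cmul \<eta>1 \<eta>2 = (\<lambda>x. \<eta>1 x * \<eta>2 x)"

definition cinv :: "('a::{finite,field} \<Rightarrow> complex) \<Rightarrow> 'a \<Rightarrow> complex" where
  "cinv \<eta> = (\<lambda>x. if x = 0 then 0 else inverse (\<eta> x))"

definition delta :: "('a::{finite,field} \<Rightarrow> complex) \<Rightarrow> nat" where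
  "delta \<eta> = (if \<eta> = eps then 1 else 0)"

definition qq :: "'a::{finite,field} itself \<Rightarrow> complex" where
  "qq _ = of_nat (card (UNIV :: 'a set))"

definition gauss :: "('a::{finite,field} \<Rightarrow> complex) \<Rightarrow> ('a \<Rightarrow> complex) \<Rightarrow> complex" where
  "gauss \<psi> \<eta> = - (\<Sum>x \<in> UNIV - {0}. \<psi> x * \<eta> x)"

definition gauss0 :: "('a::{finite,field} \<Rightarrow> complex) \<Rightarrow> ('a \<Rightarrow> complex) \<Rightarrow> complex" where
  "gauss0 \<psi> \<eta> = qq TYPE('a) ^ delta \<eta> * gauss \<psi> \<eta>"

definition poch :: "('a::{finite,field} \<Rightarrow> complex) \<Rightarrow> ('a \<Rightarrow> complex) \<Rightarrow> ('a \<Rightarrow> complex) \<Rightarrow> complex" where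
  "poch \<psi> \<alpha> \<nu> = gauss \<psi> (cmul \<alpha> \<nu>) / gauss \<psi> \<alpha>"

definition poch0 :: "('a::{finite,field} \<Rightarrow> complex) \<Rightarrow> ('a \<Rightarrow> complex) \<Rightarrow> ('a \<Rightarrow> complex) \<Rightarrow> complex" where
  "poch0 \<psi> \<alpha> \<nu> = gauss0 \<psi> (cmul \<alpha> \<nu>) / gauss0 \<psi> \<alpha>"

definition hypF :: "('a::{finite,field} \<Rightarrow> complex) \<Rightarrow> ('a \<Rightarrow> complex) list \<Rightarrow> ('a \<Rightarrow> complex) list
     \<Rightarrow> 'a \<Rightarrow> complex" where
  "hypF \<psi> as bs z = 1 / (1 - qq TYPE('a)) *
     (\<Sum>\<nu> \<in> mchars. (\<Prod>a \<leftarrow> as. poch \<psi> a \<nu>) /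
        (poch0 \<psi> eps \<nu> * (\<Prod>b \<leftarrow> bs. poch0 \<psi> b \<nu>)) * \<nu> z)"

definition appellF3 :: "('a::{finite,field} \<Rightarrow> complex) \<Rightarrow> ('a \<Rightarrow> complex) \<Rightarrow> ('a \<Rightarrow> complex)
     \<Rightarrow> ('a \<Rightarrow> complex) \<Rightarrow> ('a \<Rightarrow> complex) \<Rightarrow> ('a \<Rightarrow> complex) \<Rightarrow> 'a \<Rightarrow> 'a \<Rightarrow> complex" where
  "appellF3 \<psi> a1 a2 b1 b2 c x y = 1 / (1 - qq TYPE('a))^2 *
     (\<Sum>\<nu>1 \<in> mchars. \<Sum>\<nu>2 \<in> mchars.
        poch \<psi> a1 \<nu>1 * poch \<psi> a2 \<nu>2 * poch \<psi> b1 \<nu>1 * poch \<psi> b2 \<nu>2 /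
        (poch0 \<psi> c (cmul \<nu>1 \<nu>2) * poch0 \<psi> eps \<nu>1 * poch0 \<psi> eps \<nu>2) * \<nu>1 x * \<nu>2 y)"

end

theory Submission
  imports Defs "HOL-Algebra.Algebraic_Closure_Type"
begin

text \<open>
Since $1/g^\circ(\eta) = \eta(-1)\, g(\overline\eta)/q$ for every $\eta$, each hypergeometric function is
a character sum of products of Gauss sums without denominators. The Mellin transform of the beta kernel,
$g(\beta\nu)\, g(\overline\nu) = -g(\beta) \sum_t \overline\nu(t)\, \overline\beta(1+t)$ for
$\beta \neq \varepsilon$, together with the orthogonality of characters, turns such sums into sums of
Euler type over the field.

Part (i) is the finite field analogue of Barnes' first lemma applied to the inner sum at $y = 1$.
In part (ii) both sides are double Euler sums, matched by
$u = -(1+x)/(x\lambda)$, $v = (1+y)(1-\lambda)/\lambda$.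

In part (iii), $P = 1 + 2xu$ and $Q = -1 - 2yv$ bring the Euler sum of $F_3$ to the form
$\sum_{P,Q} \beta_1^2(1-P^2)\, \beta_2^2(1-Q^2)\, \overline\kappa(P + rQ)$ with
$\kappa = (\beta_1\beta_2\overline\gamma)^2$ and $r = (1-\lambda)/(1+\lambda)$.
The Fourier transform of $\beta^2(1-P^2)$ is a Kloosterman sum, whose Mellin coefficients are products of two
Gauss sums, and the orthogonality relation leaves the condition that the square of a character is trivial:
it has the two solutions $\varepsilon$ and $\phi$, which accounts for the sum over
$\gamma' \in \{\gamma, \gamma\phi\}$. The resulting $_2F_1$ at $r^2$ is moved to $1 - r^2 = 4\lambda/(1+\lambda)^2$
by a Moebius substitution.
\<close>


section \<open>The cyclic multiplicative group\<close>

text \<open>A character is determined by its value at a generator, so the structure of the character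
  group rests on this. The algebraic theorem is about ring records; it is applied to the type seen
  as a record with carrier \<open>UNIV\<close>.\<close>

lemma finite_field_generator:
  "\<exists>g::'a::{finite,field}. g \<noteq> 0 \<and> (\<forall>x. x \<noteq> 0 \<longrightarrow> (\<exists>n. x = g ^ n))"
proof -
  define R where "R = (ring_of_type_algebra :: 'a ring)"
  interpret R: Ring.field R
    unfolding R_def by (rule field_from_type_algebra)
  have sel: "carrier R = UNIV" "\<one>\<^bsub>R\<^esub> = 1" "\<zero>\<^bsub>R\<^esub> = 0" "x \<otimes>\<^bsub>R\<^esub> y = x * y" for x y
    by (simp_all add: R_def ring_of_type_algebra_def)
  have pow: "x [^]\<^bsub>R\<^esub> n = x ^ n" for x :: 'a and n :: nat
    by (induction n) (simp_all add: sel)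
  obtain g where "g \<in> carrier (mult_of R)" "carrier (mult_of R) = {g [^]\<^bsub>R\<^esub> i |i::nat. i \<in> UNIV}"
    using R.finite_field_mult_group_has_gen by (auto simp: sel)
  then have "g \<noteq> 0" "UNIV - {0} = range (\<lambda>i. g ^ i)"
    by (auto simp: sel pow)
  then show ?thesis
    by blast
qed

section \<open>The group of multiplicative characters\<close>

text \<open>The character group is made a type and written additively, so that \<^term>\<open>0\<close> is the trivial
character and identities between products of characters are handled by the simplifier.\<close>

typedef (overloaded) 'a mc = "mchars :: ('a::{finite,field} \<Rightarrow> complex) set"
  morphisms ev Mch
proof
  show "eps \<in> (mchars :: ('a \<Rightarrow> complex) set)"
    by (auto simp: mchars_def mchar_def eps_def)
qed

setup_lifting type_definition_mc

instantiation mc :: ("{finite,field}") ab_group_add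
begin

lift_definition zero_mc :: "'a mc" is eps
  by (auto simp: mchars_def mchar_def eps_def)

lift_definition plus_mc :: "'a mc \<Rightarrow> 'a mc \<Rightarrow> 'a mc" is cmul
  by (auto simp: mchars_def mchar_def cmul_def)

lift_definition uminus_mc :: "'a mc \<Rightarrow> 'a mc" is cinv
  by (auto simp: mchars_def mchar_def cinv_def)

definition minus_mc :: "'a mc \<Rightarrow> 'a mc \<Rightarrow> 'a mc" where
  "minus_mc a b = a + - b"

instance
proof
  fix a b c :: "'a mc"
  show "a + b + c = a + (b + c)"
    by transfer (simp add: cmul_def mult.assoc)
  show "a + b = b + a"
    by transfer (simp add: cmul_def mult.commute)
  show "0 + a = a"
    by transfer (auto simp: cmul_def eps_def mchars_def mchar_def)
  show "- a + a = 0"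
    by transfer (auto simp: cmul_def cinv_def eps_def mchars_def mchar_def)
qed (simp add: minus_mc_def)

end

lemma ev_eq_0_iff [simp]: "ev a x = 0 \<longleftrightarrow> x = 0"
  using ev[of a] by (auto simp: mchars_def mchar_def)

lemma ev_0 [simp]: "ev a 0 = 0"
  by simp

lemma ev_mult: "ev a (x * y) = ev a x * ev a y"
  using ev[of a] by (cases "x = 0 \<or> y = 0") (auto simp: mchars_def mchar_def)

lemma ev_1 [simp]: "ev a 1 = 1"
  using ev_mult[of a 1 1] ev_eq_0_iff[of a 1] by simp

lemma ev_reciprocal: "ev a (inverse x) = inverse (ev a x)"
proof (cases "x = 0")
  case False
  then have "ev a x * ev a (inverse x) = 1"
    by (simp flip: ev_mult)
  then show ?thesis
    by (metis inverse_unique)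
qed simp

lemma ev_divide: "ev a (x / y) = ev a x / ev a y"
  by (simp add: divide_inverse ev_mult ev_reciprocal)

lemma ev_power: "ev a (x ^ n) = ev a x ^ n"
  by (induction n) (simp_all add: ev_mult)

lemma ev_zero: "ev 0 x = (if x = 0 then 0 else 1)"
  by transfer (simp add: eps_def)

lemma ev_add: "ev (a + b) x = ev a x * ev b x"
  by transfer (simp add: cmul_def)

text \<open>At \<open>x = 0\<close> the convention \<open>inverse 0 = 0\<close> agrees with the
  extension of characters by 0, which makes this an unconditional rewrite rule.\<close>

lemma ev_uminus: "ev (- a) x = inverse (ev a x)"
proof (cases "x = 0")
  case False
  then show ?thesis
    by transfer (simp add: cinv_def)
qed simp

lemma ev_diff: "ev (a - b) x = ev a x / ev b x"
  by (simp add: ev_add ev_uminus divide_inverse flip: add_uminus_conv_diff)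

lemma ev_minus_1_sq: "ev a (- 1) * ev a (- 1) = 1"
  by (simp flip: ev_mult)

lemma ev_minus_1_inverse: "inverse (ev a (- 1)) = ev a (- 1)"
  using ev_minus_1_sq by (metis inverse_unique)

text \<open>Several comparisons of constants below involve, besides Gauss sums and q, only such
  signs, and end with a case split over them.\<close>

lemma ev_minus_1_cases: "ev a (- 1) = 1 \<or> ev a (- 1) = - 1"
  using ev_minus_1_sq by (simp add: square_eq_1_iff)

lemma ev_minus_1_uminus: "ev (- a) (- 1) = ev a (- 1)"
  by (simp add: ev_uminus ev_minus_1_inverse)

lemma ev_minus: "ev a (- x) = ev a (- 1) * ev a x"
  by (simp flip: ev_mult)

lemma mc_eqI: "(\<And>x. x \<noteq> 0 \<Longrightarrow> ev a x = ev b x) \<Longrightarrow> a = b"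
  by (metis ev_inject ev_0 ext)

section \<open>Characters from roots of unity\<close>

text \<open>The order of a generator is exactly q - 1: a shorter period would miss nonzero elements,
  and a longer one contradicts the pigeonhole principle.\<close>

lemma finite_field_generator_order:
  fixes g :: "'a::{finite,field}"
  assumes g: "g \<noteq> 0" "\<And>x. x \<noteq> 0 \<Longrightarrow> \<exists>n. x = g ^ n"
  shows "g ^ n = 1 \<longleftrightarrow> card (UNIV :: 'a set) - 1 dvd n"
proof -
  define N where "N = card (UNIV :: 'a set) - 1"
  have N: "card (UNIV - {0::'a}) = N"
    by (simp add: N_def card_Diff_singleton)
  have low: "N \<le> k" if k: "g ^ k = 1" "k > 0" for k
  proof -
    have "UNIV - {0} \<subseteq> (\<lambda>i. g ^ i) ` {..<k}"
    proof
      fix x :: 'a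
      assume "x \<in> UNIV - {0}"
      then obtain n where n: "x = g ^ n"
        using g by blast
      have "g ^ n = (g ^ k) ^ (n div k) * g ^ (n mod k)"
        by (metis mult_div_mod_eq power_add power_mult)
      then have "x = g ^ (n mod k)"
        using n k by simp
      then show "x \<in> (\<lambda>i. g ^ i) ` {..<k}"
        using k by simp
    qed
    then have "card (UNIV - {0::'a}) \<le> card {..<k}"
      by (meson card_image_le card_mono finite_imageI finite_lessThan le_trans)
    then show ?thesis
      using N by simp
  qed
  \<comment> \<open>The \<open>N + 1\<close> exponents in \<open>{..N}\<close> have only
    \<open>N\<close> possible values, so two powers agree. The difference of the exponents is a
    period of at most \<open>N\<close>, hence \<open>N\<close> itself by \<open>low\<close>.\<close>
  have "\<not> inj_on (\<lambda>i. g ^ i) {..N}"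
  proof
    assume "inj_on (\<lambda>i. g ^ i) {..N}"
    then have "card {..N} \<le> card (UNIV - {0::'a})"
      by (rule card_inj_on_le) (use g in auto)
    then show False
      using N by simp
  qed
  then obtain i j where ij: "i < j" "j \<le> N" "g ^ i = g ^ j"
    unfolding inj_on_def by (metis atMost_iff linorder_neqE_nat)
  have "g ^ i * g ^ (j - i) = g ^ i * 1"
    using ij by (metis le_add_diff_inverse less_imp_le mult.right_neutral power_add)
  then have "g ^ (j - i) = 1"
    using g by simp
  with low[OF this] ij have gN: "g ^ N = 1" and "N > 0"
    by (auto simp: le_diff_conv intro: antisym) 
      (metis diff_le_self le_antisym le_trans zero_less_diff)
  have "g ^ n = (g ^ N) ^ (n div N) * g ^ (n mod N)"
    by (metis mult_div_mod_eq power_add power_mult)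
  then have "g ^ n = g ^ (n mod N)"
    using gN by simp
  moreover have "n mod N = 0" if "g ^ (n mod N) = 1"
    using low[OF that] \<open>N > 0\<close> by (meson mod_less_divisor not_le neq0_conv)
  ultimately show ?thesis
    unfolding N_def[symmetric] by (metis mod_0_imp_dvd dvd_imp_mod_0 power_0)
qed

text \<open>Discrete logarithms are defined modulo q - 1, and the condition on \<open>w\<close> is
  what makes \<open>w ^ n\<close> independent of the choice made by \<open>SOME\<close>.\<close>

lemma mc_with_generator_value:
  fixes g :: "'a::{finite,field}" and w :: complex
  assumes g: "g \<noteq> 0" "\<And>x. x \<noteq> 0 \<Longrightarrow> \<exists>n. x = g ^ n"
    and w: "w ^ (card (UNIV :: 'a set) - 1) = 1"
  shows "\<exists>a. \<forall>n. ev a (g ^ n) = w ^ n"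
proof -
  \<comment> \<open>The value 0 could satisfy the hypothesis only for the exponent 0, by
    \<open>0 ^ 0 = 1\<close>; but q - 1 is positive because 0 and 1 differ.\<close>
  have w0: "w \<noteq> 0"
  proof
    assume "w = 0"
    then have "card (UNIV :: 'a set) - 1 = 0"
      using w by (metis power_0_left zero_neq_one)
    moreover have "card {0 :: 'a, 1} \<le> card (UNIV :: 'a set)"
      by (rule card_mono) simp_all
    ultimately show False
      by simp
  qed
  have le: "w ^ n = w ^ m" if "g ^ n = g ^ m" "n \<le> m" for n m
  proof -
    have "g ^ n * g ^ (m - n) = g ^ n * 1"
      using that by (metis le_add_diff_inverse mult.right_neutral power_add)
    then have "card (UNIV :: 'a set) - 1 dvd m - n"
      using g finite_field_generator_order[OF g] by simp
    then have "w ^ (m - n) = 1"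
      using w by (metis dvdE power_mult power_one)
    then show ?thesis
      using that by (metis le_add_diff_inverse mult.right_neutral power_add)
  qed
  then have wd: "w ^ n = w ^ m" if "g ^ n = g ^ m" for n m
    using that by (metis nat_le_linear)
  define f where "f x = (if x = 0 then 0 else w ^ (SOME n. x = g ^ n))" for x
  have f: "f (g ^ n) = w ^ n" for n
  proof -
    have "g ^ n = g ^ (SOME m. g ^ n = g ^ m)"
      by (rule someI) simp
    then have "w ^ n = w ^ (SOME m. g ^ n = g ^ m)"
      by (rule wd)
    then show ?thesis
      using g by (simp add: f_def)
  qed
  have "f \<in> mchars"
    unfolding mchars_def mchar_def mem_Collect_eq
  proof (intro conjI allI impI)
    fix x y :: 'a
    assume "x \<noteq> 0" "y \<noteq> 0"
    then obtain n m where "x = g ^ n" "y = g ^ m"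
      using g by blast
    then show "f (x * y) = f x * f y"
      by (simp add: f flip: power_add)
  qed (use w0 in \<open>auto simp: f_def\<close>)
  then show ?thesis
    by (metis Mch_inverse f)
qed

lemma two_le_card_field: "2 \<le> card (UNIV :: 'a::{finite,field} set)"
proof -
  have "card {0 :: 'a, 1} \<le> card (UNIV :: 'a set)"
    by (rule card_mono) simp_all
  then show ?thesis
    by simp
qed

lemma qq_nonzero [simp]: "qq TYPE('a::{finite,field}) \<noteq> 0"
  using two_le_card_field[where 'a='a] by (simp add: qq_def)

lemma qq_ne_1 [simp]: "qq TYPE('a::{finite,field}) \<noteq> 1"
proof
  assume "qq TYPE('a) = 1"
  then have "card (UNIV :: 'a set) = 1"
    unfolding qq_def using of_nat_eq_1_iff by blast
  then show False
    using two_le_card_field[where 'a='a] by simp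
qed

lemma qq_minus_1_eq: "qq TYPE('a::{finite,field}) - 1 = of_nat (card (UNIV :: 'a set) - 1)"
  using two_le_card_field[where 'a='a] by (simp add: qq_def of_nat_diff)

text \<open>Evaluation at a generator embeds the characters into the finite set of complex roots of
  unity of order dividing q - 1.\<close>

instance mc :: ("{finite,field}") finite
proof
  obtain g :: 'a where g: "g \<noteq> 0" "\<And>x. x \<noteq> 0 \<Longrightarrow> \<exists>n. x = g ^ n"
    using finite_field_generator by blast
  let ?N = "card (UNIV :: 'a set) - 1"
  have "inj (\<lambda>a. ev a g)"
    by (rule injI, rule mc_eqI) (metis g(2) ev_power)
  moreover have "range (\<lambda>a. ev a g) \<subseteq> {z. z ^ ?N = 1}"
    using finite_field_generator_order[OF g, of ?N] by (auto simp flip: ev_power)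
  moreover have "finite {z :: complex. z ^ ?N = 1}"
    using two_le_card_field[where 'a='a] by (intro finite_roots_unity) simp
  ultimately show "finite (UNIV :: 'a mc set)"
    by (metis finite_imageD finite_subset)
qed

text \<open>A character that sends a generator to a primitive root of unity of order q - 1 is
  injective on the nonzero elements.\<close>

lemma ev_separates:
  assumes "x \<noteq> 0" "x \<noteq> 1"
  shows "\<exists>a. ev a x \<noteq> 1"
proof -
  obtain g :: 'a where g: "g \<noteq> 0" "\<And>x. x \<noteq> 0 \<Longrightarrow> \<exists>n. x = g ^ n"
    using finite_field_generator by blast
  let ?N = "card (UNIV :: 'a set) - 1"
  have N: "?N > 0"
    using two_le_card_field[where 'a='a] by simp
  define w where "w = cis (2 * pi / ?N)"
  have wN: "w ^ n = 1 \<longleftrightarrow> ?N dvd n" for n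
  proof
    assume "w ^ n = 1"
    then have "cis (2 * pi * real n / ?N) = 1"
      by (simp add: w_def DeMoivre mult_ac)
    then have "cos (2 * pi * real n / ?N) = 1"
      by (metis cis.simps(1) one_complex.simps(1))
    then obtain k :: int where "2 * pi * real n / ?N = real_of_int k * 2 * pi"
      unfolding cos_one_2pi_int by blast
    moreover have "2 * pi * x / c = y * 2 * pi \<Longrightarrow> c \<noteq> 0 \<Longrightarrow> x = c * y" for x y c :: real
      by (simp add: field_simps)
    ultimately have "real n = real ?N * k"
      using N by (metis (no_types) of_nat_0_less_iff less_irrefl)
    then have "int n = int ?N * k"
      by (metis of_int_eq_iff of_int_mult of_int_of_nat_eq)
    then show "?N dvd n"
      by (metis dvd_triv_left int_dvd_int_iff)
  next
    assume "?N dvd n"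
    then obtain k where "n = ?N * k" ..
    then show "w ^ n = 1"
      using N by (simp add: w_def DeMoivre power_mult)
  qed
  then have "w ^ ?N = 1"
    by simp
  from mc_with_generator_value[OF g this] obtain a where a: "\<And>n. ev a (g ^ n) = w ^ n"
    by blast
  obtain n where n: "x = g ^ n"
    using g assms by blast
  then have "\<not> ?N dvd n"
    using assms(2) finite_field_generator_order[OF g(1)] g(2) by simp
  moreover have "ev a x = w ^ n"
    using a n by simp
  ultimately show ?thesis
    using wN[of n] by metis
qed

section \<open>Orthogonality relations\<close>

text \<open>For \<open>a \<noteq> 0\<close>, scaling the variable by some \<open>y\<close> with
  \<open>ev a y \<noteq> 1\<close> multiplies the sum by a factor other than 1 and yet only permutes
  its terms.\<close>

lemma sum_ev: "(\<Sum>x\<in>UNIV. ev (a :: 'a::{finite,field} mc) x) = (if a = 0 then qq TYPE('a) - 1 else 0)"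
proof (cases "a = 0")
  case True
  have "(\<Sum>x\<in>UNIV. ev (0 :: 'a mc) x) = (\<Sum>x\<in>UNIV - {0 :: 'a}. 1)"
    by (rule sum.mono_neutral_cong_right) (auto simp: ev_zero)
  then show ?thesis
    using True by (simp add: qq_minus_1_eq card_Diff_singleton)
next
  case False
  then obtain y where y: "y \<noteq> 0" "ev a y \<noteq> 1"
    by (metis mc_eqI ev_zero)
  have "ev a y * (\<Sum>x\<in>UNIV. ev a x) = (\<Sum>x\<in>UNIV. ev a (y * x))"
    by (simp add: sum_distrib_left ev_mult)
  also have "\<dots> = (\<Sum>x\<in>UNIV. ev a x)"
    by (rule sum.reindex_bij_witness[of _ "\<lambda>x. x / y" "\<lambda>x. y * x"]) (use y in auto)
  finally show ?thesis
    using y False by simp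
qed

lemma sum_mc: "(\<Sum>a\<in>UNIV. ev a (x :: 'a::{finite,field})) = (if x = 1 then qq TYPE('a) - 1 else 0)"
proof -
  have ne1: "(\<Sum>a\<in>UNIV. ev a x) = 0" if x: "x \<noteq> 1" for x :: 'a
  proof (cases "x = 0")
    case False
    then obtain b where b: "ev b x \<noteq> 1"
      using x ev_separates by blast
    have "ev b x * (\<Sum>a\<in>UNIV. ev a x) = (\<Sum>a\<in>UNIV. ev (b + a) x)"
      by (simp add: sum_distrib_left ev_add)
    also have "\<dots> = (\<Sum>a\<in>UNIV. ev a x)"
      by (rule sum.reindex_bij_witness[of _ "\<lambda>a. a - b" "\<lambda>a. b + a"]) auto
    finally show ?thesis
      using b by simp
  qed simp
  \<comment> \<open>The value at 1 is the number of characters. It is found by summing over all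
    \<open>x\<close> and \<open>a\<close> in both orders: in one order only \<open>x = 1\<close>
    survives, in the other only \<open>a = 0\<close>.\<close>
  have "(\<Sum>a\<in>UNIV. ev a (1 :: 'a)) = (\<Sum>x\<in>UNIV. \<Sum>a\<in>UNIV. ev a (x :: 'a))"
    using ne1 by (subst sum.remove[of _ 1]) auto
  also have "\<dots> = (\<Sum>a\<in>UNIV. \<Sum>x\<in>UNIV. ev a (x :: 'a))"
    by (rule sum.swap)
  also have "\<dots> = qq TYPE('a) - 1"
    by (simp add: sum_ev)
  finally show ?thesis
    using ne1 by auto
qed

section \<open>The quadratic character\<close>

definition quad :: "'a::{finite,field} mc" where
  "quad = Mch qchar"

text \<open>Since -1 has order two, q - 1 is even, so some character takes the value -1 at a
  generator; it separates even powers, the squares, from odd ones. A character that doubles to the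
  trivial one takes a square root of 1 at the generator, which leaves two choices.\<close>

lemma quadratic_char:
  assumes "(2 :: 'a::{finite,field}) \<noteq> 0"
  shows quad_in_mchars: "qchar \<in> (mchars :: ('a \<Rightarrow> complex) set)"
    and quad_nonzero: "quad \<noteq> (0 :: 'a mc)"
    and double_eq_0: "a + a = (0 :: 'a mc) \<longleftrightarrow> a = 0 \<or> a = quad"
proof -
  obtain g :: 'a where g: "g \<noteq> 0" "\<And>x. x \<noteq> 0 \<Longrightarrow> \<exists>n. x = g ^ n"
    using finite_field_generator by blast
  let ?N = "card (UNIV :: 'a set) - 1"
  note ord = finite_field_generator_order[OF g]
  have m1: "(- 1 :: 'a) \<noteq> 1"
    using assms by (metis add.right_inverse one_add_one)
  obtain k where k: "- 1 = g ^ k"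
    using g(2)[of "- 1"] by auto
  have "g ^ (k * 2) = 1"
    unfolding power_mult k[symmetric] by simp
  then have "?N dvd k * 2"
    using ord by blast
  moreover have "\<not> ?N dvd k"
    using ord k m1 by metis
  \<comment> \<open>An odd \<open>?N\<close> that divides \<open>k * 2\<close> would divide
    \<open>k\<close>.\<close>
  ultimately have "even ?N"
    by (metis coprime_dvd_mult_left_iff coprime_right_2_iff_odd)
  then obtain b where b: "\<And>n. ev b (g ^ n) = (- 1) ^ n"
    using mc_with_generator_value[OF g, of "- 1"] by auto
  have "ev b x = qchar x" for x
  proof (cases "x = 0")
    case False
    then obtain n where n: "x = g ^ n"
      using g by blast
    have "(\<exists>y. y ^ 2 = x) \<longleftrightarrow> even n"
    proof
      assume "\<exists>y. y ^ 2 = x"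
      then obtain y where y: "y ^ 2 = x" ..
      then obtain m where "y = g ^ m"
        using g(2)[of y] False by auto
      then have "ev b (g ^ n) = ev b (g ^ (m * 2))"
        using y n by (simp add: power_mult)
      then have "(- 1 :: complex) ^ n = 1"
        by (simp only: b) (simp add: mult.commute[of m] power_mult)
      then show "even n"
        by (simp add: uminus_power_if split: if_splits)
    next
      assume "even n"
      then obtain m where "n = m * 2"
        by (metis evenE mult.commute)
      then show "\<exists>y. y ^ 2 = x"
        using n by (metis power_mult)
    qed
    then show ?thesis
      using False by (auto simp: qchar_def n b uminus_power_if)
  qed (simp add: qchar_def)
  then have q: "qchar = ev b"
    by auto
  then show "qchar \<in> (mchars :: ('a \<Rightarrow> complex) set)"
    using ev by metis
  have quad: "quad = b"
    by (simp add: quad_def q ev_inverse)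
  show "quad \<noteq> (0 :: 'a mc)"
    using b[of 1] g by (auto simp: quad ev_zero)
  show "a + a = 0 \<longleftrightarrow> a = 0 \<or> a = quad"
  proof
    assume "a + a = 0"
    then have "ev a g * ev a g = 1"
      using g by (simp add: ev_zero flip: ev_add)
    then have "ev a g = 1 \<or> ev a g = - 1"
      by (simp add: square_eq_1_iff)
    then show "a = 0 \<or> a = quad"
    proof
      assume "ev a g = 1"
      then have "a = 0"
        by (intro mc_eqI) (metis g(2) ev_power ev_zero power_one)
      then show ?thesis ..
    next
      assume "ev a g = - 1"
      then have "a = quad"
        unfolding quad by (intro mc_eqI) (metis g(2) ev_power b)
      then show ?thesis ..
    qed
  next
    assume "a = 0 \<or> a = quad"
    moreover have "b + b = 0"
    proof (rule mc_eqI)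
      fix x :: 'a
      assume "x \<noteq> 0"
      then obtain n where "x = g ^ n"
        using g by blast
      then show "ev (b + b) x = ev 0 x"
        using g by (simp add: ev_add ev_zero b flip: power_mult_distrib)
    qed
    ultimately show "a + a = 0"
      using quad by auto
  qed
qed

lemma
  assumes two: "(2 :: 'a::{finite,field}) \<noteq> 0"
  shows ev_quad: "ev quad (x :: 'a) = qchar x"
    and quad_add_quad: "quad + quad = (0 :: 'a mc)"
    and uminus_quad: "- quad = (quad :: 'a mc)"
proof -
  show "ev quad x = qchar x"
    using Mch_inverse[OF quad_in_mchars[OF two]] by (simp add: quad_def)
  show "quad + quad = (0 :: 'a mc)"
    using double_eq_0[OF two] by blast
  then show "- quad = (quad :: 'a mc)"
    by (rule minus_unique)
qed

text \<open>The number of square roots of \<open>y\<close> is \<open>1 + ev quad y\<close>, also at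
  \<open>y = 0\<close>, where the character contributes 0.\<close>

lemma sum_squares_eq:
  fixes F :: "'a::{finite,field} \<Rightarrow> complex"
  assumes two: "(2 :: 'a) \<noteq> 0"
  shows "(\<Sum>x\<in>UNIV. F (x ^ 2)) = (\<Sum>y\<in>UNIV. F y) + (\<Sum>y\<in>UNIV. ev quad y * F y)"
proof -
  have card: "of_nat (card {x. x ^ 2 = y}) = 1 + ev quad y" for y :: 'a
  proof (cases "\<exists>x. x ^ 2 = y \<and> y \<noteq> 0")
    case True
    then obtain x where x: "x ^ 2 = y" "x \<noteq> 0"
      by auto
    then have "{x. x ^ 2 = y} = {x, - x}"
      by (auto simp: power2_eq_iff)
    moreover have "x \<noteq> - x"
      using x two by (metis add.right_inverse mult_2 mult_eq_0_iff)
    ultimately show ?thesis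
      using x by (auto simp: ev_quad[OF two] qchar_def)
  next
    case False
    then show ?thesis
      by (cases "y = 0") (auto simp: ev_quad[OF two] qchar_def)
  qed
  have "(\<Sum>x\<in>UNIV. F (x ^ 2)) = (\<Sum>y\<in>UNIV. \<Sum>x\<in>{x. x \<in> UNIV \<and> x ^ 2 = y}. F (x ^ 2))"
    by (rule sum.group[symmetric]) auto
  also have "\<dots> = (\<Sum>y\<in>UNIV. of_nat (card {x. x ^ 2 = y}) * F y)"
    by (intro sum.cong) auto
  finally show ?thesis
    by (simp add: card algebra_simps sum.distrib)
qed

section \<open>Gauss sums\<close>

text \<open>The sum over characters picks out \<open>t = s i\<close> by \<open>sum_mc\<close>; the
  factor \<open>ev 0 (s i)\<close> discards the indices with \<open>s i = 0\<close>, where every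
  character vanishes. The index set is left free so that single points, field elements and pairs can
  all be used.\<close>

lemma mellin_parseval:
  fixes f :: "'a::{finite,field} \<Rightarrow> complex"
  assumes "finite I"
  shows "(\<Sum>\<nu>\<in>UNIV. (\<Sum>t\<in>UNIV. f t * ev (- \<nu>) t) * (\<Sum>i\<in>I. h i * ev \<nu> (s i))) =
    (qq TYPE('a) - 1) * (\<Sum>i\<in>I. h i * f (s i) * ev 0 (s i))"
proof -
  have inv: "(\<Sum>t\<in>UNIV. f t * (\<Sum>\<nu>\<in>UNIV. ev \<nu> (y / t))) = (qq TYPE('a) - 1) * (f y * ev 0 y)" for y
  proof -
    have "(\<Sum>t\<in>UNIV. f t * (\<Sum>\<nu>\<in>UNIV. ev \<nu> (y / t))) =
        (\<Sum>t\<in>UNIV. if t = y then (qq TYPE('a) - 1) * (f y * ev 0 y) else 0)"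
      by (rule sum.cong) (auto simp: sum_mc ev_zero)
    then show ?thesis
      by simp
  qed
  have "(\<Sum>\<nu>\<in>UNIV. (\<Sum>t\<in>UNIV. f t * ev (- \<nu>) t) * (\<Sum>i\<in>I. h i * ev \<nu> (s i))) =
      (\<Sum>\<nu>\<in>UNIV. \<Sum>t\<in>UNIV. \<Sum>i\<in>I. h i * (f t * ev \<nu> (s i / t)))"
    by (simp add: sum_product ev_uminus ev_mult ev_reciprocal divide_inverse mult_ac)
  also have "\<dots> = (\<Sum>i\<in>I. \<Sum>\<nu>\<in>UNIV. \<Sum>t\<in>UNIV. h i * (f t * ev \<nu> (s i / t)))"
    by (subst sum.swap[of _ _ I], intro sum.cong refl, rule sum.swap)
  also have "\<dots> = (\<Sum>i\<in>I. \<Sum>t\<in>UNIV. \<Sum>\<nu>\<in>UNIV. h i * (f t * ev \<nu> (s i / t)))"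
    by (intro sum.cong refl, rule sum.swap)
  also have "\<dots> = (\<Sum>i\<in>I. h i * (\<Sum>t\<in>UNIV. f t * (\<Sum>\<nu>\<in>UNIV. ev \<nu> (s i / t))))"
    by (simp add: sum_distrib_left)
  also have "\<dots> = (qq TYPE('a) - 1) * (\<Sum>i\<in>I. h i * f (s i) * ev 0 (s i))"
    by (simp only: inv) (simp add: sum_distrib_left mult_ac)
  finally show ?thesis .
qed

section \<open>Gauss sums for a fixed additive character\<close>

locale nontrivial_addchar =
  fixes \<psi> :: "'a::{finite,field} \<Rightarrow> complex"
  assumes addchar: "addchar \<psi>" and nontrivial: "\<psi> \<noteq> (\<lambda>_. 1)"
begin

abbreviation G :: "'a mc \<Rightarrow> complex" where
  "G a \<equiv> gauss \<psi> (ev a)"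

lemma psi_0 [simp]: "\<psi> 0 = 1"
  using addchar by (simp add: addchar_def)

lemma psi_add: "\<psi> (x + y) = \<psi> x * \<psi> y"
  using addchar by (simp add: addchar_def)

lemma sum_psi: "(\<Sum>x\<in>UNIV. \<psi> (x * s)) = (if s = 0 then qq TYPE('a) else 0)"
proof (cases "s = 0")
  case False
  obtain z where z: "\<psi> z \<noteq> 1"
    using nontrivial by auto
  have "(\<Sum>x\<in>UNIV. \<psi> (x * s)) = (\<Sum>x\<in>UNIV. \<psi> (z + x))"
    by (rule sum.reindex_bij_witness[of _ "\<lambda>x. (z + x) / s" "\<lambda>x. x * s - z"])
      (use False in auto)
  moreover have "(\<Sum>x\<in>UNIV. \<psi> (x * s)) = (\<Sum>x\<in>UNIV. \<psi> x)"
    by (rule sum.reindex_bij_witness[of _ "\<lambda>x. x / s" "\<lambda>x. x * s"]) (use False in auto)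
  moreover have "(\<Sum>x\<in>UNIV. \<psi> (z + x)) = \<psi> z * (\<Sum>x\<in>UNIV. \<psi> x)"
    by (simp add: psi_add sum_distrib_left)
  ultimately show ?thesis
    using z False by simp
qed (simp add: qq_def)

lemma G_eq: "G a = - (\<Sum>x\<in>UNIV. ev a x * \<psi> x)"
  unfolding gauss_def
  by (simp, rule sum.mono_neutral_cong_left) (auto simp: mult.commute)

lemma G_0 [simp]: "G 0 = 1"
proof -
  have "(\<Sum>x\<in>UNIV - {0}. \<psi> x) = (\<Sum>x\<in>UNIV. \<psi> (x * 1)) - \<psi> 0"
    by (simp add: sum_diff1)
  also have "\<dots> = - 1"
    by (simp only: sum_psi) simp
  finally have "(\<Sum>x\<in>UNIV - {0}. \<psi> x) = - 1" .
  moreover have "(\<Sum>x\<in>UNIV - {0}. \<psi> x * ev 0 x) = (\<Sum>x\<in>UNIV - {0}. \<psi> x)"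
    by (rule sum.cong) (simp_all add: ev_zero)
  ultimately show ?thesis
    by (simp add: gauss_def)
qed

text \<open>Scaling \<open>w\<close> by \<open>s\<close> gives the Gauss sum. At
  \<open>s = 0\<close> the right side is 0, and the left side is too unless \<open>a = 0\<close>,
  when it is q - 1; this is the one excluded case.\<close>

lemma sum_ev_psi:
  assumes "a \<noteq> 0 \<or> s \<noteq> 0"
  shows "(\<Sum>w\<in>UNIV. ev a w * \<psi> (w * s)) = - ev (- a) s * G a"
proof (cases "s = 0")
  case True
  then show ?thesis
    using assms by (simp add: sum_ev)
next
  case False
  have "(\<Sum>w\<in>UNIV. ev a w * \<psi> (w * s)) = (\<Sum>w\<in>UNIV. ev a (w / s) * \<psi> w)"
    by (rule sum.reindex_bij_witness[of _ "\<lambda>x. x / s" "\<lambda>x. x * s"]) (use False in auto)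
  then show ?thesis
    by (simp add: G_eq ev_mult ev_reciprocal ev_uminus sum_distrib_left sum_negf divide_inverse mult_ac)
qed

text \<open>The substitution is \<open>x = t * w\<close>. The sum over \<open>w\<close> stays
  unevaluated because its value differs in the two cases needed later:
  \<open>a + b \<noteq> 0\<close> gives Jacobi sums, \<open>a + b = 0\<close> gives
  reflection.\<close>

lemma G_mult_G:
  "G a * G b = (\<Sum>t\<in>UNIV. ev a t * (\<Sum>w\<in>UNIV. ev (a + b) w * \<psi> (w * (1 + t))))"
proof -
  have "G a * G b = (\<Sum>w\<in>UNIV. \<Sum>x\<in>UNIV. ev a x * ev b w * \<psi> (x + w))"
    by (subst sum.swap) (simp add: G_eq sum_product psi_add mult_ac)
  also have "\<dots> = (\<Sum>w\<in>UNIV. \<Sum>t\<in>UNIV. ev a (t * w) * ev b w * \<psi> (t * w + w))"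
  proof (rule sum.cong)
    fix w :: 'a
    show "(\<Sum>x\<in>UNIV. ev a x * ev b w * \<psi> (x + w)) =
        (\<Sum>t\<in>UNIV. ev a (t * w) * ev b w * \<psi> (t * w + w))"
    proof (cases "w = 0")
      case False
      show ?thesis
        by (rule sum.reindex_bij_witness[of _ "\<lambda>x. x * w" "\<lambda>x. x / w"]) (use False in auto)
    qed simp
  qed simp
  also have "\<dots> = (\<Sum>t\<in>UNIV. \<Sum>w\<in>UNIV. ev a (t * w) * ev b w * \<psi> (t * w + w))"
    by (rule sum.swap)
  also have "\<dots> = (\<Sum>t\<in>UNIV. ev a t * (\<Sum>w\<in>UNIV. ev (a + b) w * \<psi> (w * (1 + t))))"
    by (simp add: sum_distrib_left ev_mult ev_add algebra_simps)
  finally show ?thesis .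
qed

lemma G_mult_G_jacobi:
  assumes "a + b \<noteq> 0"
  shows "G a * G b = - G (a + b) * (\<Sum>t\<in>UNIV. ev a t * ev (- a - b) (1 + t))"
  using assms by (simp add: G_mult_G sum_ev_psi sum_distrib_left mult_ac sum_negf)

text \<open>For \<open>b = - a\<close> the inner sum of \<open>G_mult_G\<close> is a point mass q at
  \<open>t = - 1\<close> minus the constant 1, and orthogonality kills the constant.\<close>

lemma G_reflect:
  assumes "a \<noteq> 0"
  shows "G a * G (- a) = ev a (- 1) * qq TYPE('a)"
proof -
  have "(\<Sum>w\<in>UNIV. ev (a + - a) w * \<psi> (w * (1 + t))) = (if t = - 1 then qq TYPE('a) else 0) - 1" for t
  proof -
    have "(\<Sum>w\<in>UNIV. ev (a + - a) w * \<psi> (w * (1 + t))) =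
        (\<Sum>w\<in>UNIV - {0}. \<psi> (w * (1 + t)))"
      by (rule sum.mono_neutral_cong_right) (auto simp: ev_zero)
    also have "\<dots> = (\<Sum>w\<in>UNIV. \<psi> (w * (1 + t))) - 1"
      by (simp add: sum_diff1)
    also have "1 + t = 0 \<longleftrightarrow> t = - 1"
      by (metis add.commute add_eq_0_iff)
    then have "(\<Sum>w\<in>UNIV. \<psi> (w * (1 + t))) = (if t = - 1 then qq TYPE('a) else 0)"
      by (simp add: sum_psi)
    finally show ?thesis .
  qed
  then have "G a * G (- a) = (\<Sum>t\<in>UNIV. ev a t * (if t = - 1 then qq TYPE('a) else 0)) - (\<Sum>t\<in>UNIV. ev a t)"
    by (simp only: G_mult_G right_diff_distrib sum_subtractf mult_1_right)
  then show ?thesis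
    using assms by (simp add: sum_ev if_distrib cong: if_cong)
qed

lemma G_nonzero [simp]: "G a \<noteq> 0"
  using G_reflect[of a] G_0 by (cases "a = 0") auto

section \<open>Hypergeometric functions without denominators\<close>

text \<open>The extra factor q at the trivial character makes reflection hold for every character. A
  \<open>gauss0\<close> in a denominator can therefore always be traded for a Gauss sum in the
  numerator.\<close>

lemma gauss0_reflect: "gauss0 \<psi> (ev a) * G (- a) = ev a (- 1) * qq TYPE('a)"
proof (cases "a = 0")
  case True
  then show ?thesis
    by (simp add: gauss0_def delta_def zero_mc.rep_eq[symmetric] ev_zero)
next
  case False
  then have "ev a \<noteq> eps"
    by (metis ev_inject zero_mc.rep_eq)
  then show ?thesis
    using G_reflect False by (simp add: gauss0_def delta_def)
qed

lemma gauss0_eq: "gauss0 \<psi> (ev a) = ev a (- 1) * qq TYPE('a) / G (- a)"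
  by (simp add: eq_divide_eq gauss0_reflect)

lemma poch0_eq: "poch0 \<psi> (ev c) (ev n) = ev n (- 1) * G (- c) / G (- c - n)"
  by (simp add: poch0_def gauss0_eq ev_add flip: plus_mc.rep_eq)

lemma poch_eq: "poch \<psi> (ev c) (ev n) = G (c + n) / G c"
  by (simp add: poch_def flip: plus_mc.rep_eq)

lemma mchars_eq: "mchars = range (ev :: 'a mc \<Rightarrow> _)"
  by (rule type_definition.Rep_range[OF type_definition_mc, symmetric])

lemma sum_mchars: "(\<Sum>\<nu>\<in>mchars. F \<nu>) = (\<Sum>n\<in>UNIV. F (ev (n :: 'a mc)))"
  unfolding mchars_eq by (subst sum.reindex) (auto simp: inj_def ev_inject)

lemma appellF3_eq:
  "appellF3 \<psi> (ev a1) (ev a2) (ev b1) (ev b2) (ev c) x y =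
    (\<Sum>m\<in>UNIV. \<Sum>n\<in>UNIV. G (a1 + m) * G (b1 + m) * G (- m) * (G (a2 + n) * G (b2 + n) * G (- n)) *
      G (- c - m - n) * ev m x * ev n y) /
    ((1 - qq TYPE('a)) ^ 2 * (G a1 * G a2 * G b1 * G b2 * G (- c)))"
proof -
  have summand: "poch \<psi> (ev a1) (ev m) * poch \<psi> (ev a2) (ev n) * poch \<psi> (ev b1) (ev m) * poch \<psi> (ev b2) (ev n) /
        (poch0 \<psi> (ev c) (cmul (ev m) (ev n)) * poch0 \<psi> eps (ev m) * poch0 \<psi> eps (ev n)) * ev m x * ev n y
      = 1 / (G a1 * G a2 * G b1 * G b2 * G (- c)) *
        (G (a1 + m) * G (b1 + m) * G (- m) * (G (a2 + n) * G (b2 + n) * G (- n)) *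
          G (- c - m - n) * ev m x * ev n y)" for m n
  proof -
    \<comment> \<open>The signs come from the three \<open>poch0\<close> factors; those of
      \<open>m\<close> and of \<open>n\<close> each occur twice.\<close>
    have "ev m (- 1) * (ev m (- 1) * (ev n (- 1) * ev n (- 1))) = 1"
      by (simp add: ev_minus_1_sq)
    moreover have "- c - (m + n) = - c - m - n"
      by simp
    ultimately show ?thesis
      unfolding poch_eq zero_mc.rep_eq[symmetric] plus_mc.rep_eq[symmetric] poch0_eq
      by (simp add: field_simps ev_add ev_minus_1_sq del: diff_add_eq_diff_diff_swap)
  qed
  show ?thesis
    unfolding appellF3_def sum_mchars summand sum_distrib_left[symmetric]
    by simp
qed

text \<open>Three \<open>poch0\<close> factors leave one sign \<open>ev n (- 1)\<close>, which is
  absorbed into the argument \<open>- z\<close>. The Gauss sums are grouped in the pairs that become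
  Jacobi sums in \<open>hypF_3_2_integral\<close>.\<close>

lemma hypF_3_2_eq:
  "hypF \<psi> [ev a, ev b, ev c] [ev d, ev e] z =
    (\<Sum>n\<in>UNIV. G (a + n) * G (- n) * (G (b + n) * G (- d - n)) * (G (c + n) * G (- e - n)) * ev n (- z)) /
    ((1 - qq TYPE('a)) * (G a * G b * G c * G (- d) * G (- e)))"
proof -
  have summand: "prod_list (map (\<lambda>a. poch \<psi> a (ev n)) [ev a, ev b, ev c]) /
        (poch0 \<psi> eps (ev n) * prod_list (map (\<lambda>b. poch0 \<psi> b (ev n)) [ev d, ev e])) * ev n z
      = 1 / (G a * G b * G c * G (- d) * G (- e)) *
        (G (a + n) * G (- n) * (G (b + n) * G (- d - n)) * (G (c + n) * G (- e - n)) * ev n (- z))" for n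
    unfolding zero_mc.rep_eq[symmetric] list.map prod_list.Cons prod_list.Nil poch_eq poch0_eq
        ev_minus[of n z]
    by (simp add: field_simps ev_minus_1_sq)
  show ?thesis
    unfolding hypF_def sum_mchars summand sum_distrib_left[symmetric]
    by simp
qed

lemma hypF_2_1_eq:
  "hypF \<psi> [ev a, ev b] [ev d] z =
    (\<Sum>n\<in>UNIV. G (a + n) * G (b + n) * G (- n) * G (- d - n) * ev n z) /
    ((1 - qq TYPE('a)) * (G a * G b * G (- d)))"
proof -
  have summand: "prod_list (map (\<lambda>a. poch \<psi> a (ev n)) [ev a, ev b]) /
        (poch0 \<psi> eps (ev n) * prod_list (map (\<lambda>b. poch0 \<psi> b (ev n)) [ev d])) * ev n z
      = 1 / (G a * G b * G (- d)) *
        (G (a + n) * G (b + n) * G (- n) * G (- d - n) * ev n z)" for n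
    unfolding zero_mc.rep_eq[symmetric] list.map prod_list.Cons prod_list.Nil poch_eq poch0_eq
    by (simp add: field_simps ev_minus_1_sq)
  show ?thesis
    unfolding hypF_def sum_mchars summand sum_distrib_left[symmetric]
    by simp
qed


section \<open>Reduction formulas\<close>

text \<open>The characters \<open>- n\<close> and \<open>b + n\<close> add up to \<open>b\<close>,
  so their Jacobi sum is the Mellin transform in \<open>n\<close> of a function that does not depend
  on \<open>n\<close>.\<close>

lemma beta_kernel:
  assumes "b \<noteq> 0"
  shows "G (b + n) * G (- n) = - G b * (\<Sum>t\<in>UNIV. ev (- b) (1 + t) * ev (- n) t)"
  using G_mult_G_jacobi[of "- n" "b + n"] assms by (simp add: mult_ac)

text \<open>Finite field analogue of the Barnes integral. With \<open>d\<close> the inverse of the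
  lower parameter it is the numerator in \<open>hypF_2_1_eq\<close>.\<close>

definition barnes_sum :: "'a mc \<Rightarrow> 'a mc \<Rightarrow> 'a mc \<Rightarrow> 'a \<Rightarrow> complex" where
  "barnes_sum a b d z = (\<Sum>n\<in>UNIV. G (a + n) * G (b + n) * G (- n) * G (d - n) * ev n z)"

text \<open>The pair \<open>a + n\<close>, \<open>- n\<close> is a beta kernel, the pair
  \<open>b + n\<close>, \<open>d - n\<close> is expanded by \<open>G_mult_G\<close>, and Parseval
  joins them into a sum of Euler type.\<close>

lemma barnes_sum_integral:
  assumes "a \<noteq> 0" "z \<noteq> 0" and "b + d \<noteq> 0 \<or> z = 1"
  shows "barnes_sum a b d z =
    (qq TYPE('a) - 1) * G a * G (b + d) *
      (\<Sum>s\<in>UNIV. ev b s * ev (- a) (1 + s * z) * ev (- b - d) (1 + s))"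
proof -
  define K where "K s = (\<Sum>w\<in>UNIV. ev (b + d) w * \<psi> (w * (1 + s)))" for s
  have "G (b + n) * G (d - n) = (\<Sum>s\<in>UNIV. ev b s * K s * ev n s)" for n
    using G_mult_G[of "b + n" "d - n"] by (simp add: K_def ev_add mult_ac)
  then have "barnes_sum a b d z = (\<Sum>n\<in>UNIV. - G a *
      ((\<Sum>t\<in>UNIV. ev (- a) (1 + t) * ev (- n) t) * (\<Sum>s\<in>UNIV. ev b s * K s * ev n (s * z))))"
    unfolding barnes_sum_def
  proof (intro sum.cong refl)
    fix n
    assume *: "\<And>n. G (b + n) * G (d - n) = (\<Sum>s\<in>UNIV. ev b s * K s * ev n s)"
    have z: "(\<Sum>s\<in>UNIV. ev b s * K s * ev n (s * z)) = (\<Sum>s\<in>UNIV. ev b s * K s * ev n s) * ev n z"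
      by (simp add: ev_mult sum_distrib_right mult.assoc)
    have "G (a + n) * G (b + n) * G (- n) * G (d - n) * ev n z =
        (G (a + n) * G (- n)) * ((G (b + n) * G (d - n)) * ev n z)"
      by (simp add: mult_ac)
    also have "\<dots> = - G a * ((\<Sum>t\<in>UNIV. ev (- a) (1 + t) * ev (- n) t) *
        (\<Sum>s\<in>UNIV. ev b s * K s * ev n (s * z)))"
      unfolding beta_kernel[OF assms(1)] * z by (simp only: mult.assoc)
    finally show "G (a + n) * G (b + n) * G (- n) * G (d - n) * ev n z =
        - G a * ((\<Sum>t\<in>UNIV. ev (- a) (1 + t) * ev (- n) t) *
        (\<Sum>s\<in>UNIV. ev b s * K s * ev n (s * z)))" .
  qed
  also have "\<dots> = - G a * ((qq TYPE('a) - 1) *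
      (\<Sum>s\<in>UNIV. ev b s * K s * ev (- a) (1 + s * z) * ev 0 (s * z)))"
    by (simp only: sum_distrib_left[symmetric] mellin_parseval[OF finite])
  also have "(\<Sum>s\<in>UNIV. ev b s * K s * ev (- a) (1 + s * z) * ev 0 (s * z)) =
      (\<Sum>s\<in>UNIV. - G (b + d) * (ev b s * ev (- a) (1 + s * z) * ev (- b - d) (1 + s)))"
  proof (rule sum.cong[OF refl])
    fix s
    show "ev b s * K s * ev (- a) (1 + s * z) * ev 0 (s * z) =
        - G (b + d) * (ev b s * ev (- a) (1 + s * z) * ev (- b - d) (1 + s))"
    proof (cases "s = 0 \<or> 1 + s * z = 0")
      case False
      \<comment> \<open>The evaluation fails only for \<open>b + d = 0\<close> and
        \<open>s = - 1\<close>. Under the alternative \<open>z = 1\<close> that point satisfies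
        \<open>1 + s * z = 0\<close> and has been split off, because the factor of
        \<open>- a\<close> vanishes there.\<close>
      then have "K s = - ev (- b - d) (1 + s) * G (b + d)"
        using assms(3) sum_ev_psi[of "b + d" "1 + s"] by (auto simp: K_def)
      then show ?thesis
        using False assms by (simp add: ev_zero mult_ac)
    qed auto
  qed
  finally show ?thesis
    by (simp only: sum_distrib_left[symmetric]) (simp add: mult_ac)
qed

text \<open>The right side is \<open>- G b * G (e - b)\<close> divided by \<open>gauss0\<close> of
  \<open>e\<close>, rewritten by reflection. This form also covers \<open>e = 0\<close>, which
  \<open>G_mult_G_jacobi\<close> excludes.\<close>

lemma jacobi_sum_eq:
  assumes "b \<noteq> 0"
  shows "(\<Sum>s\<in>UNIV. ev b s * ev (- e) (1 + s)) = - ev e (- 1) * G (- e) * G b * G (e - b) / qq TYPE('a)"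
proof (cases "e = 0")
  case True
  \<comment> \<open>For \<open>e = 0\<close> the second factor merely removes the point
    \<open>s = - 1\<close>.\<close>
  have "(\<Sum>s\<in>UNIV. ev b s * ev 0 (1 + s)) = (\<Sum>s\<in>UNIV. ev b s - (if s = - 1 then ev b s else 0))"
    by (rule sum.cong) (auto simp: ev_zero add_eq_0_iff)
  also have "\<dots> = - ev b (- 1)"
    using assms by (simp add: sum_subtractf sum_ev)
  finally show ?thesis
    using True G_reflect[OF assms] by (simp add: ev_zero)
next
  case False
  then have "G b * G (e - b) = - G e * (\<Sum>s\<in>UNIV. ev b s * ev (- e) (1 + s))"
    using G_mult_G_jacobi[of b "e - b"] by simp
  then have "ev e (- 1) * G (- e) * (G b * G (e - b)) =
      - (ev e (- 1) * (G e * G (- e)) * (\<Sum>s\<in>UNIV. ev b s * ev (- e) (1 + s)))"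
    by (simp add: mult_ac)
  also have "\<dots> = - ((ev e (- 1) * ev e (- 1)) * qq TYPE('a) * (\<Sum>s\<in>UNIV. ev b s * ev (- e) (1 + s)))"
    unfolding G_reflect[OF False] by (simp add: mult_ac)
  finally show ?thesis
    by (simp add: ev_minus_1_sq eq_divide_eq mult_ac)
qed

text \<open>The finite field analogue of Barnes' first lemma.\<close>

lemma barnes_sum_1:
  assumes "a \<noteq> 0" "b \<noteq> 0"
  shows "barnes_sum a b d 1 = (1 - qq TYPE('a)) / qq TYPE('a) * ev (a + b + d) (- 1) *
    (G a * G b * G (a + d) * G (b + d) * G (- (a + b + d)))"
proof -
  have "(\<Sum>s\<in>UNIV. ev b s * ev (- a) (1 + s * 1) * ev (- b - d) (1 + s)) =
      (\<Sum>s\<in>UNIV. ev b s * ev (- (a + b + d)) (1 + s))"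
  proof (rule sum.cong[OF refl])
    fix s
    have "- (a + b + d) = - a + (- b - d)"
      by simp
    then show "ev b s * ev (- a) (1 + s * 1) * ev (- b - d) (1 + s) =
        ev b s * ev (- (a + b + d)) (1 + s)"
      by (simp only: ev_add) (simp add: mult.assoc)
  qed
  moreover have "a + b + d - b = a + d"
    by simp
  ultimately show ?thesis
    using barnes_sum_integral[of a 1 b d] assms
    by (simp only: jacobi_sum_eq[OF assms(2)]) (simp add: field_simps)
qed

text \<open>At \<open>y = 1\<close> the sum over \<open>n\<close> is a Barnes sum with last
  parameter \<open>- c - m\<close>. Its closed form brings three Gauss sums in \<open>m\<close>,
  which complete the three already present to the six of a 3F2.\<close>

lemma appellF3_at_1:
  assumes "a2 \<noteq> 0" "b2 \<noteq> 0"
  shows "appellF3 \<psi> (ev a1) (ev a2) (ev b1) (ev b2) (ev c) x 1 =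
    gauss0 \<psi> (ev c) * G (- (a2 + b2) + c) / (gauss0 \<psi> (ev (- a2 + c)) * gauss0 \<psi> (ev (- b2 + c))) *
    hypF \<psi> [ev a1, ev b1, ev (- (a2 + b2) + c)] [ev (- a2 + c), ev (- b2 + c)] x"
proof -
  define H where "H = (\<Sum>m\<in>UNIV. G (a1 + m) * G (- m) * (G (b1 + m) * G (- (- a2 + c) - m)) *
    (G (- (a2 + b2) + c + m) * G (- (- b2 + c) - m)) * ev m (- x))"
  have "(\<Sum>n\<in>UNIV. G (a1 + m) * G (b1 + m) * G (- m) * (G (a2 + n) * G (b2 + n) * G (- n)) *
      G (- c - m - n) * ev m x * ev n 1) =
      (1 - qq TYPE('a)) / qq TYPE('a) * ev (a2 + b2 + c) (- 1) * G a2 * G b2 *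
      (G (a1 + m) * G (- m) * (G (b1 + m) * G (- (- a2 + c) - m)) *
    (G (- (a2 + b2) + c + m) * G (- (- b2 + c) - m)) * ev m (- x))" for m
  proof -
    have "(\<Sum>n\<in>UNIV. G (a1 + m) * G (b1 + m) * G (- m) * (G (a2 + n) * G (b2 + n) * G (- n)) *
        G (- c - m - n) * ev m x * ev n 1) =
        G (a1 + m) * G (b1 + m) * G (- m) * ev m x * barnes_sum a2 b2 (- c - m) 1"
      by (simp add: barnes_sum_def sum_distrib_left mult_ac)
    moreover have "a2 + (- c - m) = - (- a2 + c) - m" "b2 + (- c - m) = - (- b2 + c) - m"
      "- (a2 + b2 + (- c - m)) = - (a2 + b2) + c + m"
      by (simp_all add: algebra_simps)
    moreover have "ev (a2 + b2 + (- c - m)) (- 1) = ev (a2 + b2 + c) (- 1) * ev m (- 1)"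
      by (simp add: ev_add ev_diff ev_uminus ev_minus_1_inverse divide_inverse)
    ultimately show ?thesis
      by (simp only: barnes_sum_1[OF assms] ev_minus[of m x]) (simp add: mult_ac)
  qed
  then have "appellF3 \<psi> (ev a1) (ev a2) (ev b1) (ev b2) (ev c) x 1 =
      (1 - qq TYPE('a)) / qq TYPE('a) * ev (a2 + b2 + c) (- 1) * G a2 * G b2 * H /
      ((1 - qq TYPE('a)) ^ 2 * (G a1 * G a2 * G b1 * G b2 * G (- c)))"
    unfolding appellF3_eq H_def sum_distrib_left by simp
  also have "\<dots> = ev (a2 + b2 + c) (- 1) * H /
      (qq TYPE('a) * (1 - qq TYPE('a)) * (G a1 * G b1 * G (- c)))"
  proof -
    have "r / qq TYPE('a) * ev (a2 + b2 + c) (- 1) * G a2 * G b2 * H /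
        (r ^ 2 * (G a1 * G a2 * G b1 * G b2 * G (- c))) =
        ev (a2 + b2 + c) (- 1) * H / (qq TYPE('a) * r * (G a1 * G b1 * G (- c)))"
      if "r \<noteq> 0" for r
      using that by (simp add: power2_eq_square)
    then show ?thesis
      by simp
  qed
  also have "\<dots> = gauss0 \<psi> (ev c) * G (- (a2 + b2) + c) /
      (gauss0 \<psi> (ev (- a2 + c)) * gauss0 \<psi> (ev (- b2 + c))) *
      (H / ((1 - qq TYPE('a)) * (G a1 * G b1 * G (- (a2 + b2) + c) * G (- (- a2 + c)) * G (- (- b2 + c)))))"
  proof -
    \<comment> \<open>Comparison of constants: \<open>s\<close>, \<open>s2\<close>,
      \<open>s3\<close> are the signs of \<open>c\<close>, \<open>a2\<close>, \<open>b2\<close> at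
      -1, and \<open>g\<close>, \<open>g1\<close>, \<open>g2\<close> are the Gauss sums produced by
      reflecting the three \<open>gauss0\<close> values.\<close>
    have *: "s2 * s3 * s * H / (q * r * (A * B * g)) =
        s * q / g * C / (s2 * s * q / g1 * (s3 * s * q / g2)) * (H / (r * (A * B * C * g1 * g2)))"
      if "s = 1 \<or> s = - 1" "s2 = 1 \<or> s2 = - 1" "s3 = 1 \<or> s3 = - 1"
        "q \<noteq> 0" "r \<noteq> 0" "A \<noteq> 0" "B \<noteq> 0" "C \<noteq> 0" "g \<noteq> 0" "g1 \<noteq> 0" "g2 \<noteq> 0"
      for s s2 s3 q r A B C g g1 g2 :: complex
      using that by (elim disjE) simp_all
    show ?thesis
      unfolding gauss0_eq ev_add[of _ _ "- 1"] ev_minus_1_uminus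
      by (rule *) (use qq_ne_1[where 'a='a] in \<open>simp_all add: ev_minus_1_cases\<close>)
  qed
  finally show ?thesis
    unfolding hypF_3_2_eq H_def .
qed


section \<open>Double Euler sums and the reduction at (z, z / (z - 1))\<close>

text \<open>A two-dimensional Jacobi sum: the variables of \<open>a\<close> and \<open>b\<close> are
  scaled by the variable \<open>w\<close> of \<open>c\<close>, and the sum over \<open>w\<close> is
  evaluated by \<open>sum_ev_psi\<close>. It runs over pairs so that it fits
  \<open>mellin_parseval\<close>.\<close>

lemma G_mult_G_mult_G:
  assumes "a + b + c \<noteq> 0"
  shows "G a * G b * G c = G (a + b + c) *
    (\<Sum>(u, v)\<in>UNIV. ev a u * ev b v * ev (- (a + b + c)) (1 + u + v))"
proof -
  have sub: "G a * (ev (b + c) w * \<psi> (w * (1 + v))) =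
      - (\<Sum>u\<in>UNIV. ev a u * (ev (a + b + c) w * \<psi> (w * (1 + u + v))))" for v w
  proof (cases "w = 0")
    case False
    have *: "(\<Sum>x\<in>UNIV. ev a x * \<psi> x) = (\<Sum>u\<in>UNIV. ev a (u * w) * \<psi> (u * w))"
      by (rule sum.reindex_bij_witness[of _ "\<lambda>x. x * w" "\<lambda>x. x / w"]) (use False in auto)
    show ?thesis
      unfolding G_eq * mult_minus_left sum_distrib_right
      by (simp add: ev_mult ev_add psi_add distrib_left mult_ac)
  qed simp
  have "G a * G b * G c = (\<Sum>v\<in>UNIV. ev b v * (\<Sum>w\<in>UNIV. G a * (ev (b + c) w * \<psi> (w * (1 + v)))))"
    using G_mult_G[of b c] by (simp add: sum_distrib_left mult_ac)
  also have "\<dots> = - (\<Sum>v\<in>UNIV. \<Sum>w\<in>UNIV. \<Sum>u\<in>UNIV.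
      ev a u * ev b v * (ev (a + b + c) w * \<psi> (w * (1 + u + v))))"
    unfolding sub by (simp add: sum_negf sum_distrib_left mult_ac)
  also have "\<dots> = - (\<Sum>v\<in>UNIV. \<Sum>u\<in>UNIV. \<Sum>w\<in>UNIV.
      ev a u * ev b v * (ev (a + b + c) w * \<psi> (w * (1 + u + v))))"
    by (subst sum.swap) (rule refl)
  also have "\<dots> = (\<Sum>v\<in>UNIV. \<Sum>u\<in>UNIV.
      G (a + b + c) * (ev a u * ev b v * ev (- (a + b + c)) (1 + u + v)))"
    unfolding sum_distrib_left[symmetric] sum_ev_psi[OF disjI1[OF assms]]
    by (simp add: sum_negf sum_distrib_left mult_ac)
  also have "\<dots> = (\<Sum>u\<in>UNIV. \<Sum>v\<in>UNIV.
      G (a + b + c) * (ev a u * ev b v * ev (- (a + b + c)) (1 + u + v)))"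
    by (rule sum.swap)
  finally show ?thesis
    by (simp add: sum_distrib_left sum.cartesian_product case_prod_beta)
qed

text \<open>The characters \<open>a1 + m\<close>, \<open>a2 + n\<close>, \<open>- c - m - n\<close>
  have a constant sum, so their Gauss sums form a double sum in which \<open>m\<close> and
  \<open>n\<close> enter only as evaluations at \<open>u\<close> and \<open>v\<close>. The other
  pairs are beta kernels, and Parseval, first in \<open>n\<close> and then in \<open>m\<close>,
  evaluates them at \<open>v * y\<close> and \<open>u * x\<close>.\<close>

lemma appellF3_integral:
  assumes "a1 + a2 - c \<noteq> 0" "b1 \<noteq> 0" "b2 \<noteq> 0" "x \<noteq> 0" "y \<noteq> 0"
  shows "appellF3 \<psi> (ev a1) (ev a2) (ev b1) (ev b2) (ev c) x y =
    G (a1 + a2 - c) / (G a1 * G a2 * G (- c)) *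
    (\<Sum>(u, v)\<in>UNIV. ev a1 u * ev a2 v * ev (- (a1 + a2 - c)) (1 + u + v) *
      ev (- b1) (1 + u * x) * ev (- b2) (1 + v * y))"
proof -
  let ?k = "a1 + a2 - c"
  let ?q = "qq TYPE('a)"
  define h where "h p = ev a1 (fst p) * ev a2 (snd p) * ev (- ?k) (1 + fst p + snd p)" for p
  have tri: "G (a1 + m) * G (a2 + n) * G (- c - m - n) =
      G ?k * (\<Sum>p\<in>UNIV. h p * ev m (fst p) * ev n (snd p))" for m n
  proof -
    have "a1 + m + (a2 + n) + (- c - m - n) = ?k"
      by (simp add: algebra_simps)
    then show ?thesis
      using G_mult_G_mult_G[of "a1 + m" "a2 + n" "- c - m - n"] assms(1)
      by (simp add: h_def case_prod_beta ev_add mult_ac)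
  qed
  define B where "B b n = (\<Sum>t\<in>UNIV. ev (- b) (1 + t) * ev (- n) t)" for b n :: "'a mc"
  note B = beta_kernel[folded B_def]
  have summand: "G (a1 + m) * G (b1 + m) * G (- m) * (G (a2 + n) * G (b2 + n) * G (- n)) *
      G (- c - m - n) * ev m x * ev n y =
      G b1 * G b2 * G ?k *
      (B b1 m * (B b2 n * (\<Sum>p\<in>UNIV. h p * ev m (fst p * x) * ev n (snd p * y))))" for m n
  proof -
    have "G (a1 + m) * G (b1 + m) * G (- m) * (G (a2 + n) * G (b2 + n) * G (- n)) *
      G (- c - m - n) * ev m x * ev n y =
      (G (b1 + m) * G (- m)) * (G (b2 + n) * G (- n)) *
      ((G (a1 + m) * G (a2 + n) * G (- c - m - n)) * (ev m x * ev n y))"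
      by (simp add: mult_ac)
    also have "(G (a1 + m) * G (a2 + n) * G (- c - m - n)) * (ev m x * ev n y) =
        G ?k * (\<Sum>p\<in>UNIV. h p * ev m (fst p * x) * ev n (snd p * y))"
      unfolding tri mult.assoc[of "G ?k"] sum_distrib_right by (simp add: ev_mult mult_ac)
    finally show ?thesis
      unfolding B[OF assms(2)] B[OF assms(3)] by (simp add: mult_ac)
  qed
  have "(\<Sum>m\<in>UNIV. \<Sum>n\<in>UNIV. B b1 m * (B b2 n * (\<Sum>p\<in>UNIV. h p * ev m (fst p * x) * ev n (snd p * y)))) =
      (\<Sum>m\<in>UNIV. B b1 m * ((?q - 1) * (\<Sum>p\<in>UNIV. h p * ev m (fst p * x) *
        ev (- b2) (1 + snd p * y) * ev 0 (snd p * y))))"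
    unfolding sum_distrib_left[symmetric] by (simp only: B_def mellin_parseval[OF finite])
  also have "\<dots> = (?q - 1) * (\<Sum>m\<in>UNIV. B b1 m * (\<Sum>p\<in>UNIV.
      (h p * ev (- b2) (1 + snd p * y) * ev 0 (snd p * y)) * ev m (fst p * x)))"
    by (simp add: sum_distrib_left mult_ac)
  also have "\<dots> = (?q - 1) ^ 2 * (\<Sum>p\<in>UNIV.
      h p * ev (- b2) (1 + snd p * y) * ev 0 (snd p * y) * ev (- b1) (1 + fst p * x) * ev 0 (fst p * x))"
    by (simp only: B_def mellin_parseval[OF finite]) (simp add: power2_eq_square)
  also have "(\<Sum>p\<in>UNIV. h p * ev (- b2) (1 + snd p * y) * ev 0 (snd p * y) *
        ev (- b1) (1 + fst p * x) * ev 0 (fst p * x)) =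
      (\<Sum>(u, v)\<in>UNIV. ev a1 u * ev a2 v * ev (- ?k) (1 + u + v) *
        ev (- b1) (1 + u * x) * ev (- b2) (1 + v * y))"
    \<comment> \<open>For nonzero \<open>x\<close> and \<open>y\<close> the factors
      \<open>ev 0\<close> vanish only at \<open>u = 0\<close> or \<open>v = 0\<close>, where
      \<open>h\<close> is already 0.\<close>
    using assms(4,5) by (intro sum.cong) (auto simp: h_def ev_zero)
  finally have "(\<Sum>m\<in>UNIV. \<Sum>n\<in>UNIV. G (a1 + m) * G (b1 + m) * G (- m) * (G (a2 + n) * G (b2 + n) * G (- n)) *
      G (- c - m - n) * ev m x * ev n y) =
      G b1 * G b2 * G ?k * ((?q - 1) ^ 2 * (\<Sum>(u, v)\<in>UNIV. ev a1 u * ev a2 v * ev (- ?k) (1 + u + v) *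
        ev (- b1) (1 + u * x) * ev (- b2) (1 + v * y)))"
    unfolding summand sum_distrib_left[symmetric] by (rule arg_cong)
  then show ?thesis
    using qq_ne_1[where 'a='a] unfolding appellF3_eq by (simp add: power2_commute[of 1])
qed

text \<open>The pairs \<open>b\<close>, \<open>d\<close> and \<open>c\<close>, \<open>e\<close> give
  one Jacobi sum each, in \<open>x\<close> and \<open>y\<close>. The pair of \<open>a\<close> with
  the trivial character is a beta kernel, which Parseval evaluates at
  \<open>- z * x * y\<close>.\<close>

lemma hypF_3_2_integral:
  assumes "a \<noteq> 0" "b - d \<noteq> 0" "c - e \<noteq> 0" "z \<noteq> 0"
  shows "hypF \<psi> [ev a, ev b, ev c] [ev d, ev e] z =
    G (b - d) * G (c - e) / (G b * G c * G (- d) * G (- e)) *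
    (\<Sum>(x, y)\<in>UNIV. ev b x * ev c y * ev (d - b) (1 + x) * ev (e - c) (1 + y) *
      ev (- a) (1 - z * x * y))"
proof -
  let ?q = "qq TYPE('a)"
  have beta: "G (b + n) * G (- d - n) = - G (b - d) * (\<Sum>x\<in>UNIV. ev b x * ev (d - b) (1 + x) * ev n x)"
    if "b - d \<noteq> 0" for b d n :: "'a mc"
  proof -
    have "b + n + (- d - n) = b - d" "- (b + n) - (- d - n) = d - b"
      by (simp_all add: algebra_simps)
    then show ?thesis
      using that G_mult_G_jacobi[of "b + n" "- d - n"] by (simp add: ev_add mult_ac)
  qed
  define h where "h p = ev b (fst p) * ev c (snd p) * ev (d - b) (1 + fst p) * ev (e - c) (1 + snd p)" for p
  have prod: "(\<Sum>x\<in>UNIV. ev b x * ev (d - b) (1 + x) * ev n x) *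
      (\<Sum>y\<in>UNIV. ev c y * ev (e - c) (1 + y) * ev n y) * ev n (- z) =
      (\<Sum>p\<in>UNIV. h p * ev n (fst p * snd p * (- z)))" for n
  proof -
    have "(\<Sum>x\<in>UNIV. ev b x * ev (d - b) (1 + x) * ev n x) *
      (\<Sum>y\<in>UNIV. ev c y * ev (e - c) (1 + y) * ev n y) * ev n (- z) =
      (\<Sum>x\<in>UNIV. \<Sum>y\<in>UNIV. h (x, y) * ev n (x * y * (- z)))"
      unfolding sum_product unfolding sum_distrib_right by (simp add: h_def ev_mult mult_ac del: mult_minus_right)
    then show ?thesis
      by (simp add: sum.cartesian_product case_prod_beta)
  qed
  have "G (a + n) * G (- n) * (G (b + n) * G (- d - n)) * (G (c + n) * G (- e - n)) * ev n (- z) =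
      - G a * G (b - d) * G (c - e) * ((\<Sum>t\<in>UNIV. ev (- a) (1 + t) * ev (- n) t) *
      (\<Sum>p\<in>UNIV. h p * ev n (fst p * snd p * (- z))))" for n
    unfolding beta_kernel[OF assms(1)] beta[OF assms(2)] beta[OF assms(3)] prod[symmetric]
    by (simp only: mult_minus_left mult_minus_right mult_ac minus_minus)
  then have "(\<Sum>n\<in>UNIV. G (a + n) * G (- n) * (G (b + n) * G (- d - n)) * (G (c + n) * G (- e - n)) * ev n (- z)) =
      - G a * G (b - d) * G (c - e) * ((?q - 1) *
      (\<Sum>p\<in>UNIV. h p * ev (- a) (1 + fst p * snd p * (- z)) * ev 0 (fst p * snd p * (- z))))"
    by (simp only: sum_distrib_left[symmetric] mellin_parseval[OF finite])
  also have "(\<Sum>p\<in>UNIV. h p * ev (- a) (1 + fst p * snd p * (- z)) * ev 0 (fst p * snd p * (- z))) =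
      (\<Sum>(x, y)\<in>UNIV. ev b x * ev c y * ev (d - b) (1 + x) * ev (e - c) (1 + y) *
      ev (- a) (1 - z * x * y))"
    using assms(4) by (intro sum.cong) (auto simp: h_def ev_zero mult_ac)
  finally have S: "(\<Sum>n\<in>UNIV. G (a + n) * G (- n) * (G (b + n) * G (- d - n)) * (G (c + n) * G (- e - n)) * ev n (- z)) =
      (1 - ?q) * (G a * G (b - d) * G (c - e) * 
      (\<Sum>(x, y)\<in>UNIV. ev b x * ev c y * ev (d - b) (1 + x) * ev (e - c) (1 + y) *
      ev (- a) (1 - z * x * y)))"
    by (simp add: algebra_simps)
  show ?thesis
    using qq_ne_1[where 'a='a] unfolding hypF_3_2_eq S by (simp add: mult.assoc)
qed


text \<open>Under the change of variables each of the five factors on the left becomes, up to a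
  constant, a monomial in \<open>x\<close>, \<open>y\<close>, \<open>1 + x\<close>,
  \<open>1 + y\<close> and \<open>1 - (1 - z) * x * y\<close>, with exponents of either
  sign.\<close>

lemma appellF3_substitution:
  fixes z :: 'a
  assumes "z \<noteq> 0" "z \<noteq> 1" and k: "k = a1 + a2 - c"
  shows "(\<Sum>(u, v)\<in>UNIV. ev a1 u * ev a2 v * ev (- k) (1 + u + v) *
      ev (- b1) (1 + u * z) * ev (- b2) (1 + v * (z / (z - 1)))) =
    ev (a2 + b1 + b2 + c) (- 1) * ev (- c) z * ev a2 (1 - z) *
    (\<Sum>(x, y)\<in>UNIV. ev (a2 + b1 - c) x * ev (- b2) y * ev a1 (1 + x) * ev a2 (1 + y) *
      ev (- k) (1 - (1 - z) * x * y))"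
    (is "(\<Sum>(u, v)\<in>UNIV. ?L u v) = ?K * (\<Sum>(x, y)\<in>UNIV. ?R x y)")
proof -
  define f where "f = (\<lambda>(x, y). (- (1 + x) / (x * z), (1 + y) * (1 - z) / z))"
  \<comment> \<open>The equations \<open>1 + u * z = - 1 / x\<close> and
    \<open>v * z / (1 - z) = 1 + y\<close> solved for \<open>x\<close> and \<open>y\<close>.\<close>
  define g where "g = (\<lambda>(u, v). (- 1 / (1 + u * z), v * z / (1 - z) - 1))"
  have z1: "1 - z \<noteq> 0" "z - 1 \<noteq> 0"
    using assms by simp_all
  have fst_f: "1 + fst (f p) * z = - 1 / fst p" if "fst p \<noteq> 0" for p
  proof -
    have "1 + - (1 + x) / (x * z) * z = - 1 / x" if "x \<noteq> 0" for x
      using that assms(1) by (simp add: field_simps)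
    then show ?thesis
      using that unfolding f_def case_prod_beta fst_conv by blast
  qed
  have gf: "g (f p) = p" if x: "fst p \<noteq> 0" for p
  proof -
    have "g (f p) = (- 1 / (1 + fst (f p) * z), snd (f p) * z / (1 - z) - 1)"
      by (simp only: g_def case_prod_beta)
    also have "\<dots> = p"
      unfolding fst_f[OF x] using assms(1) z1 x by (simp add: f_def case_prod_beta prod_eq_iff)
    finally show ?thesis .
  qed
  have fg: "f (g p) = p" if "1 + fst p * z \<noteq> 0" for p
  proof -
    have "- (1 + - 1 / w) / (- 1 / w * z) = (w - 1) / z" if "w \<noteq> 0" for w
      using that assms(1) by (simp add: field_simps)
    from this[OF that] show ?thesis
      using assms(1) z1 by (simp add: f_def g_def case_prod_beta prod_eq_iff)
  qed
  have eq: "(case f (x, y) of (u, v) \<Rightarrow> ?L u v) = ?K * ?R x y" if x: "x \<noteq> 0" for x y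
  proof -
    let ?u = "- (1 + x) / (x * z)" and ?v = "(1 + y) * (1 - z) / z"
    have 1: "1 + ?u * z = - 1 / x"
      using x assms(1) by (simp add: field_simps)
    have 2: "1 + ?v * (z / (z - 1)) = - 1 * y"
      using z1 assms(1) by (simp add: divide_eq_eq add_divide_eq_iff) (simp add: algebra_simps)
    have 3: "1 + ?u + ?v = - 1 * ((1 - (1 - z) * x * y) / (x * z))"
      using x assms(1) by (simp add: field_simps)
    have 4: "- (1 + x) / (x * z) = - 1 * ((1 + x) / (x * z))"
      by simp
    have "?L ?u ?v = ?K * ?R x y"
    proof (cases "y = 0 \<or> 1 - (1 - z) * x * y = 0")
      case True
      then show ?thesis
        unfolding 2 3 by auto
    next
      case False
      then have W: "1 - (1 - z) * x * y \<noteq> 0" and y: "y \<noteq> 0"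
        by simp_all
      define W where "W = 1 - (1 - z) * x * y"
      show ?thesis
        unfolding 1 2 3 unfolding 4 k ev_mult ev_divide ev_add ev_diff ev_uminus W_def[symmetric]
        using W[folded W_def] x y assms(1)
          ev_minus_1_cases[of a1] ev_minus_1_cases[of a2] ev_minus_1_cases[of b1]
          ev_minus_1_cases[of b2] ev_minus_1_cases[of c]
        by (auto simp: inverse_eq_divide mult_ac)
    qed
    then show ?thesis
      by (simp add: f_def)
  qed
  have "(\<Sum>(u, v)\<in>UNIV. ?L u v) = (\<Sum>p\<in>UNIV. ?K * ?R (fst p) (snd p))"
  \<comment> \<open>The maps are mutually inverse only off \<open>x = 0\<close> and
    \<open>1 + u * z = 0\<close>; the summands vanish at these places.\<close>
  proof (rule sum.reindex_bij_witness_not_neutral[where i = f and j = g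
        and S' = "{p. 1 + fst p * z = 0}" and T' = "{p. fst p = 0}"])
    fix p :: "'a \<times> 'a"
    assume "p \<in> UNIV - {p. 1 + fst p * z = 0}"
    then show "g p \<in> UNIV - {p. fst p = 0}" "f (g p) = p"
      by (simp_all add: fg) (simp add: g_def case_prod_beta)
  next
    fix p :: "'a \<times> 'a"
    assume p: "p \<in> UNIV - {p. fst p = 0}"
    then have "1 + fst (f p) * z \<noteq> 0"
      by (subst fst_f) auto
    with p show "f p \<in> UNIV - {p. 1 + fst p * z = 0}" "g (f p) = p"
      by (simp_all add: gf)
  next
    fix p :: "'a \<times> 'a"
    show "?K * ?R (fst (g p)) (snd (g p)) = (case p of (u, v) \<Rightarrow> ?L u v)"
    proof (cases "1 + fst p * z = 0")
      case True
      then show ?thesis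
        by (simp add: g_def case_prod_beta)
    next
      case False
      then have "fst (g p) \<noteq> 0"
        by (simp add: g_def case_prod_beta)
      from eq[OF this, of "snd (g p)"] show ?thesis
        by (simp only: prod.collapse fg[OF False])
    qed
  qed (auto simp: case_prod_beta)
  then show ?thesis
    by (simp add: sum_distrib_left case_prod_beta)
qed

text \<open>For \<open>z \<noteq> 0\<close> both sides are constants times the same double Euler sum
  \<open>S\<close>. On the right the differences of upper and lower parameters are
  \<open>- a1\<close> and \<open>- a2\<close>, so reflection brings their Gauss sums to those on the
  left.\<close>

lemma appellF3_line:
  assumes "b1 \<noteq> 0" "b2 \<noteq> 0" "a1 \<noteq> 0" "a2 \<noteq> 0" "a1 + a2 - c \<noteq> 0" "z \<noteq> 1"
  shows "appellF3 \<psi> (ev a1) (ev a2) (ev b1) (ev b2) (ev c) z (z / (z - 1)) =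
    G (a1 + a2 - c) * G (a2 + b1 - c) * G (- b2) /
      (G (- c) * gauss0 \<psi> (ev (a1 + a2 + b1 - c)) * gauss0 \<psi> (ev (a2 - b2))) *
    ev (- c) z * ev a2 (1 - z) *
    hypF \<psi> [ev (a1 + a2 - c), ev (a2 + b1 - c), ev (- b2)] [ev (a1 + a2 + b1 - c), ev (a2 - b2)] (1 - z)"
proof (cases "z = 0")
  case True
  \<comment> \<open>Every character, the trivial one included, vanishes at 0, so both sides are
    0.\<close>
  then show ?thesis
    by (simp add: appellF3_eq)
next
  case False
  let ?k = "a1 + a2 - c" and ?D = "a1 + a2 + b1 - c" and ?E = "a2 - b2"
  let ?B = "a2 + b1 - c" and ?C = "- b2"
  define S where "S = (\<Sum>(x, y)\<in>UNIV. ev ?B x * ev (- b2) y * ev a1 (1 + x) * ev a2 (1 + y) *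
      ev (- ?k) (1 - (1 - z) * x * y))"
  have eqs: "?B - ?D = - a1" "?C - ?E = - a2" "?D - ?B = a1" "?E - ?C = a2"
    by (simp_all add: algebra_simps)
  have L: "appellF3 \<psi> (ev a1) (ev a2) (ev b1) (ev b2) (ev c) z (z / (z - 1)) =
      G ?k / (G a1 * G a2 * G (- c)) * (ev (a2 + b1 + b2 + c) (- 1) * ev (- c) z * ev a2 (1 - z) * S)"
    using appellF3_integral[of a1 a2 c b1 b2 z "z / (z - 1)"] appellF3_substitution[of z ?k a1 a2 c b1 b2]
      assms False by (simp add: S_def)
  have R: "hypF \<psi> [ev ?k, ev ?B, ev ?C] [ev ?D, ev ?E] (1 - z) =
      G (- a1) * G (- a2) / (G ?B * G ?C * G (- ?D) * G (- ?E)) * S"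
    using hypF_3_2_integral[of ?k ?B ?D ?C ?E "1 - z"] assms
    unfolding eqs S_def by simp
  have a1: "G (- a1) = ev a1 (- 1) * qq TYPE('a) / G a1" and a2: "G (- a2) = ev a2 (- 1) * qq TYPE('a) / G a2"
    using G_reflect assms(3,4) by (simp_all add: field_simps)
  have *: "K / (g1 * g2 * g) * (t2 * s1 * s2 * t * w1 * w2 * S) =
      K * B * C / (g * (t1 * t2 * s1 / t * q / D) * (t2 / s2 * q / E)) * w1 * w2 *
        ((t1 * q / g1) * (t2 * q / g2) / (B * C * D * E) * S)"
    if "t1 = 1 \<or> t1 = - 1" "t2 = 1 \<or> t2 = - 1" "s1 = 1 \<or> s1 = - 1" "s2 = 1 \<or> s2 = - 1" "t = 1 \<or> t = - 1"
      "q \<noteq> 0" "B \<noteq> 0" "C \<noteq> 0" "D \<noteq> 0" "E \<noteq> 0"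
    for t1 t2 s1 s2 t q g1 g2 g w1 w2 B C D E K S :: complex
    using that by (auto simp: mult_ac)
  show ?thesis
    unfolding L R gauss0_eq a1 a2 ev_add[of _ _ "- 1"] ev_diff[of _ _ "- 1"]
    by (rule *) (use qq_ne_1[where 'a='a] in \<open>simp_all add: ev_minus_1_cases\<close>)
qed


section \<open>The connection formula and the quadratic transformation\<close>

text \<open>Passage from \<open>z\<close> to \<open>1 - z\<close>. Over a finite field it is a
  Moebius change of variable in the Euler sum and has a single term; the three conditions on
  characters are what \<open>barnes_sum_integral\<close> needs on the two sides.\<close>

lemma barnes_sum_connection:
  assumes "a \<noteq> 0" "b + d \<noteq> 0" "a + d \<noteq> 0" "z \<noteq> 0" "z \<noteq> 1"
  shows "barnes_sum a b d z = ev b (- 1) * ev (- (a + b + d)) (1 - z) * G (b + d) / G (- a - d) *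
    barnes_sum (- a - d) (- b - d) (a + b + d) (1 - z)"
proof -
  let ?K = "ev b (- 1) * ev (- (a + b + d)) (1 - z)"
  have z: "1 - z \<noteq> 0"
    using assms by simp
  have dn: "1 + s * (1 - z) = 0 \<longleftrightarrow> s = - 1 / (1 - z)" for s
    by (simp only: add_eq_0_iff nonzero_eq_divide_eq[OF z])
  have "(\<Sum>s\<in>UNIV. ev b s * ev (- a) (1 + s * z) * ev (- b - d) (1 + s)) =
      (\<Sum>s\<in>UNIV. ?K * (ev (- b - d) s * ev (a + d) (1 + s * (1 - z)) * ev (- a) (1 + s)))"
  proof (rule sum.reindex_bij_witness_not_neutral[where j = "\<lambda>s. - (1 + s) / (s * (1 - z))"
        and i = "\<lambda>s. - 1 / (1 + s * (1 - z))" and S' = "{0}" and T' = "{- 1 / (1 - z)}"])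
    fix s
    assume "s \<in> UNIV - {0 :: 'a}"
    then have s: "s \<noteq> 0"
      by simp
    have 1: "1 + - (1 + s) / (s * (1 - z)) * (1 - z) = - 1 / s"
      using s z by (simp add: field_simps)
    show "- 1 / (1 + - (1 + s) / (s * (1 - z)) * (1 - z)) = s"
      unfolding 1 using s by simp
    have "1 + - (1 + s) / (s * (1 - z)) * (1 - z) \<noteq> 0"
      unfolding 1 using s by simp
    then show "- (1 + s) / (s * (1 - z)) \<in> UNIV - {- 1 / (1 - z)}"
      using dn by blast
  next
    fix s
    assume "s \<in> UNIV - {- 1 / (1 - z)}"
    then have s: "1 + s * (1 - z) \<noteq> 0"
      using dn by blast
    then show "- 1 / (1 + s * (1 - z)) \<in> UNIV - {0}"
      by simp
    have "- (1 + - 1 / w) / (- 1 / w * (1 - z)) = (w - 1) / (1 - z)" if "w \<noteq> 0" for w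
      using that z by (simp add: divide_simps)
    from this[OF s] show "- (1 + - 1 / (1 + s * (1 - z))) / (- 1 / (1 + s * (1 - z)) * (1 - z)) = s"
      using z by simp
  next
    fix s :: 'a
    show "?K * (ev (- b - d) (- (1 + s) / (s * (1 - z))) *
        ev (a + d) (1 + - (1 + s) / (s * (1 - z)) * (1 - z)) *
        ev (- a) (1 + - (1 + s) / (s * (1 - z)))) =
      ev b s * ev (- a) (1 + s * z) * ev (- b - d) (1 + s)"
    proof (cases "s = 0")
      case False
      define y where "y = 1 - z"
      have y: "y \<noteq> 0" and zy: "z = 1 - y"
        using z by (simp_all add: y_def)
      have 1: "1 + - (1 + s) / (s * y) * y = - 1 * (1 / s)"
        using False y by (simp add: field_simps)
      have 2: "1 + - (1 + s) / (s * y) = - 1 * ((1 + s * z) / (s * y))"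
        using False y by (simp add: zy field_simps)
      have 3: "- (1 + s) / (s * y) = - 1 * ((1 + s) / (s * y))"
        by simp
      show ?thesis
      proof (cases "1 + s = 0 \<or> 1 + s * z = 0")
        case True
        then show ?thesis
          unfolding y_def[symmetric] 1 2 unfolding 3 by (auto simp: add_eq_0_iff)
      next
        case nz: False
        show ?thesis
          unfolding y_def[symmetric] 1 2 unfolding 3 ev_mult ev_divide ev_add ev_diff ev_uminus
          using nz False y ev_minus_1_cases[of a] ev_minus_1_cases[of b] ev_minus_1_cases[of d]
          by (auto simp: inverse_eq_divide mult_ac add_eq_0_iff)
      qed
    qed simp
  qed (use dn in auto)
  then have "(\<Sum>s\<in>UNIV. ev b s * ev (- a) (1 + s * z) * ev (- b - d) (1 + s)) =
      ?K * (\<Sum>s\<in>UNIV. ev (- b - d) s * ev (- (- a - d)) (1 + s * (1 - z)) * ev (- (- b - d) - (a + b + d)) (1 + s))"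
    by (simp add: sum_distrib_left add.commute)
  moreover have "- a - d \<noteq> 0" "- b - d + (a + b + d) \<noteq> 0"
    using assms by (auto simp: algebra_simps)
  ultimately show ?thesis
    using barnes_sum_integral[of a z b d] barnes_sum_integral[of "- a - d" "1 - z" "- b - d" "a + b + d"] assms
    by (simp add: mult_ac)
qed

lemma G_quad_sq:
  assumes two: "(2 :: 'a) \<noteq> 0"
  shows "G quad * G quad = ev quad (- 1 :: 'a) * qq TYPE('a)"
  using G_reflect[OF quad_nonzero[OF two]] by (simp add: uminus_quad[OF two])

text \<open>Completing the square reduces the sum to one over squares, which
  \<open>sum_squares_eq\<close> turns into a Gauss sum of \<open>quad\<close>.\<close>

lemma sum_psi_quadratic:
  assumes two: "(2 :: 'a) \<noteq> 0" and "t \<noteq> 0"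
  shows "(\<Sum>x\<in>UNIV. \<psi> (t * (1 - x ^ 2) + w * x)) =
    - G quad * ev quad (- 1 :: 'a) * ev quad t * (\<psi> t * \<psi> (w ^ 2 / 4 / t))"
proof -
  have four: "(4 :: 'a) \<noteq> 0"
    using two by (metis mult_eq_0_iff mult_2 numeral_Bit0)
  \<comment> \<open>The vertex of the quadratic exponent, whose value there is
    \<open>t + t * v ^ 2\<close>.\<close>
  define v where "v = w / (2 * t)"
  have w: "w = 2 * t * v" and v: "w ^ 2 / 4 / t = t * v ^ 2"
    using assms(2) two four by (simp_all add: v_def power2_eq_square)
  have "(\<Sum>x\<in>UNIV. \<psi> (t * (1 - x ^ 2) + w * x)) = (\<Sum>x\<in>UNIV. \<psi> t * \<psi> (w ^ 2 / 4 / t) * \<psi> (x ^ 2 * (- t)))"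
  proof (rule sum.reindex_bij_witness[of _ "\<lambda>x. x + v" "\<lambda>x. x - v"])
    fix x
    have "t * (1 - x ^ 2) + w * x = t + t * v ^ 2 + (x - v) ^ 2 * (- t)"
      by (simp add: w power2_eq_square algebra_simps)
    then show "\<psi> t * \<psi> (w ^ 2 / 4 / t) * \<psi> ((x - v) ^ 2 * (- t)) = \<psi> (t * (1 - x ^ 2) + w * x)"
      by (simp only: psi_add v)
  qed auto
  also have "\<dots> = \<psi> t * \<psi> (w ^ 2 / 4 / t) * ((\<Sum>y\<in>UNIV. \<psi> (y * (- t))) + (\<Sum>y\<in>UNIV. ev quad y * \<psi> (y * (- t))))"
    by (simp only: sum_distrib_left[symmetric] sum_squares_eq[OF two, of "\<lambda>y. \<psi> (y * (- t))"])
  also have "(\<Sum>y\<in>UNIV. \<psi> (y * (- t))) = 0"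
    using assms(2) by (simp only: sum_psi) simp
  also have "(\<Sum>y\<in>UNIV. ev quad y * \<psi> (y * (- t))) = - ev quad (- t) * G quad"
    using assms(2) by (subst sum_ev_psi) (simp_all add: uminus_quad[OF two])
  finally show ?thesis
    by (simp add: ev_minus[of quad t] mult_ac)
qed

text \<open>Mellin inversion for \<open>\<psi>\<close>, whose transform is \<open>- G (- n)\<close>;
  Parseval is used with a one-point index set.\<close>

lemma psi_mellin:
  assumes "y \<noteq> 0"
  shows "(\<Sum>n\<in>UNIV. G (- n) * ev n y) = (1 - qq TYPE('a)) * \<psi> y"
proof -
  have "(\<Sum>n\<in>UNIV. (\<Sum>t\<in>UNIV. \<psi> t * ev (- n) t) * ev n y) = (qq TYPE('a) - 1) * \<psi> y"
    using mellin_parseval[of "{()}" \<psi> "\<lambda>_. 1" "\<lambda>_. y"] assms by (simp add: ev_zero)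
  moreover have "(\<Sum>n\<in>UNIV. G (- n) * ev n y) = - (\<Sum>n\<in>UNIV. (\<Sum>t\<in>UNIV. \<psi> t * ev (- n) t) * ev n y)"
    by (simp add: G_eq sum_negf mult.commute)
  ultimately show ?thesis
    by (simp add: algebra_simps)
qed

text \<open>The left side contains a twisted Kloosterman sum. Expanding only
  \<open>\<psi> (m / t)\<close> into characters leaves a Gauss sum over \<open>t\<close>.\<close>

lemma kloosterman_mellin:
  assumes "m \<noteq> 0"
  shows "(qq TYPE('a) - 1) * (\<Sum>t\<in>UNIV. ev e t * (\<psi> t * \<psi> (m / t))) =
    (\<Sum>n\<in>UNIV. G (- n) * G (e - n) * ev n m)"
proof -
  have "(qq TYPE('a) - 1) * (\<Sum>t\<in>UNIV. ev e t * (\<psi> t * \<psi> (m / t))) =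
      - (\<Sum>t\<in>UNIV. ev e t * \<psi> t * ((1 - qq TYPE('a)) * \<psi> (m / t)))"
  proof -
    have "(qq TYPE('a) - 1) * S = - ((1 - qq TYPE('a)) * S)" for S
      by (simp add: algebra_simps)
    then show ?thesis
      by (simp only:) (simp add: sum_distrib_left mult_ac)
  qed
  also have "\<dots> = - (\<Sum>t\<in>UNIV. \<Sum>n\<in>UNIV. ev e t * \<psi> t * (G (- n) * ev n (m / t)))"
  proof (intro arg_cong[of _ _ uminus] sum.cong refl)
    fix t
    show "ev e t * \<psi> t * ((1 - qq TYPE('a)) * \<psi> (m / t)) =
        (\<Sum>n\<in>UNIV. ev e t * \<psi> t * (G (- n) * ev n (m / t)))"
      using assms psi_mellin[of "m / t"] by (cases "t = 0") (simp_all flip: sum_distrib_left)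
  qed
  also have "\<dots> = - (\<Sum>n\<in>UNIV. \<Sum>t\<in>UNIV. G (- n) * ev n m * (ev (e - n) t * \<psi> t))"
    by (subst sum.swap) (simp add: ev_divide ev_diff mult_ac)
  also have "\<dots> = (\<Sum>n\<in>UNIV. G (- n) * G (e - n) * ev n m)"
    unfolding sum_distrib_left[symmetric] by (simp add: G_eq[of "e - _"] sum_negf mult_ac)
  finally show ?thesis .
qed

text \<open>Multiplication by \<open>G (- e)\<close> writes \<open>ev e (1 - x ^ 2)\<close> as a sum
  of additive characters. The sum over \<open>x\<close> is then quadratic Gauss, which contributes
  the extra \<open>quad\<close>, and a Kloosterman sum over \<open>t\<close> remains.\<close>

lemma quadratic_fourier:
  assumes two: "(2 :: 'a) \<noteq> 0" and "e \<noteq> 0" "w \<noteq> 0"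
  shows "(qq TYPE('a) - 1) * G (- e) * (\<Sum>x\<in>UNIV. ev e (1 - x ^ 2) * \<psi> (w * x)) =
    G quad * ev quad (- 1 :: 'a) * (\<Sum>n\<in>UNIV. G (- n) * G (quad - e - n) * ev n (w ^ 2 / 4))"
proof -
  have four: "(4 :: 'a) \<noteq> 0"
    using two by (metis mult_eq_0_iff mult_2 numeral_Bit0)
  have "G (- e) * ev e s = - (\<Sum>t\<in>UNIV. ev (- e) t * \<psi> (t * s))" for s
    using sum_ev_psi[of "- e" s] assms(2) by simp
  then have "G (- e) * (\<Sum>x\<in>UNIV. ev e (1 - x ^ 2) * \<psi> (w * x)) =
      (\<Sum>x\<in>UNIV. - (\<Sum>t\<in>UNIV. ev (- e) t * \<psi> (t * (1 - x ^ 2))) * \<psi> (w * x))"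
    by (simp add: sum_distrib_left flip: mult.assoc)
  also have "\<dots> = - (\<Sum>t\<in>UNIV. ev (- e) t * (\<Sum>x\<in>UNIV. \<psi> (t * (1 - x ^ 2) + w * x)))"
    unfolding sum_distrib_left sum_distrib_right mult_minus_left sum_negf
    by (subst sum.swap) (simp add: psi_add mult_ac)
  also have "\<dots> = - (\<Sum>t\<in>UNIV. - G quad * ev quad (- 1 :: 'a) * (ev (quad - e) t * (\<psi> t * \<psi> (w ^ 2 / 4 / t))))"
  proof (intro arg_cong[of _ _ uminus] sum.cong refl)
    fix t
    show "ev (- e) t * (\<Sum>x\<in>UNIV. \<psi> (t * (1 - x ^ 2) + w * x)) =
        - G quad * ev quad (- 1 :: 'a) * (ev (quad - e) t * (\<psi> t * \<psi> (w ^ 2 / 4 / t)))"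
    proof (cases "t = 0")
      case False
      have "ev (quad - e) t = ev (- e) t * ev quad t"
        by (simp add: ev_diff ev_uminus divide_inverse)
      then show ?thesis
        unfolding sum_psi_quadratic[OF two False] by (simp only: mult_minus_left mult_minus_right mult_ac)
    qed simp
  qed
  also have "\<dots> = G quad * ev quad (- 1 :: 'a) * (\<Sum>t\<in>UNIV. ev (quad - e) t * (\<psi> t * \<psi> (w ^ 2 / 4 / t)))"
    unfolding sum_distrib_left[symmetric] by simp
  finally have *: "G (- e) * (\<Sum>x\<in>UNIV. ev e (1 - x ^ 2) * \<psi> (w * x)) =
      G quad * ev quad (- 1 :: 'a) * (\<Sum>t\<in>UNIV. ev (quad - e) t * (\<psi> t * \<psi> (w ^ 2 / 4 / t)))" .
  have "w ^ 2 / 4 \<noteq> 0"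
    using assms(3) four by simp
  from kloosterman_mellin[OF this, of "quad - e"] show ?thesis
    unfolding mult.assoc[of "qq TYPE('a) - 1" "G (- e)"] *
    by (metis (no_types) mult.left_commute)
qed


text \<open>Expanding the last factor additively in \<open>w\<close> separates \<open>x\<close> from
  \<open>y\<close> into two Fourier transforms. Their Mellin expansions in \<open>m\<close> and
  \<open>n\<close>, summed over \<open>w\<close>, force the double of \<open>k + m + n\<close> to be
  trivial.\<close>

lemma quadratic_integral:
  assumes two: "(2 :: 'a) \<noteq> 0" and "e \<noteq> 0" "f \<noteq> 0" "k + k \<noteq> 0" "r \<noteq> 0"
  shows "(1 - qq TYPE('a)) * (G (- e) * G (- f)) * G (k + k) *
      (\<Sum>(x, y)\<in>UNIV. ev e (1 - x ^ 2) * ev f (1 - y ^ 2) * ev (- (k + k)) (x + r * y)) =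
    ev quad (- 1 :: 'a) * qq TYPE('a) * ev (k + k) 2 *
      (\<Sum>k'\<in>{k, k + quad}. barnes_sum k' (quad - e + k') (quad - f) (r ^ 2))"
proof -
  let ?q = "qq TYPE('a)"
  define A where "A e w = (\<Sum>x\<in>UNIV. ev e (1 - x ^ 2) * \<psi> (w * x))" for e w
  define S where "S = (\<Sum>(x, y)\<in>UNIV. ev e (1 - x ^ 2) * ev f (1 - y ^ 2) * ev (- (k + k)) (x + r * y))"
  define H where "H e m = G (- m) * G (quad - e - m)" for e m
  have four: "(4 :: 'a) \<noteq> 0"
    using two by (metis mult_eq_0_iff mult_2 numeral_Bit0)
  have q1: "?q - 1 \<noteq> 0"
    by simp
  have "- G (k + k) * S = (\<Sum>x\<in>UNIV. \<Sum>y\<in>UNIV. ev e (1 - x ^ 2) * ev f (1 - y ^ 2) *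
      (\<Sum>w\<in>UNIV. ev (k + k) w * \<psi> (w * (x + r * y))))"
    unfolding sum_ev_psi[OF disjI1[OF assms(4)]] S_def
    by (simp add: sum_distrib_left sum_negf case_prod_beta mult_ac sum.cartesian_product)
  also have "\<dots> = (\<Sum>x\<in>UNIV. \<Sum>y\<in>UNIV. \<Sum>w\<in>UNIV. ev (k + k) w *
      ((ev e (1 - x ^ 2) * \<psi> (w * x)) * (ev f (1 - y ^ 2) * \<psi> (w * r * y))))"
    by (simp add: sum_distrib_left psi_add distrib_left mult_ac)
  also have "\<dots> = (\<Sum>x\<in>UNIV. \<Sum>w\<in>UNIV. \<Sum>y\<in>UNIV. ev (k + k) w *
      ((ev e (1 - x ^ 2) * \<psi> (w * x)) * (ev f (1 - y ^ 2) * \<psi> (w * r * y))))"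
    by (rule sum.cong[OF refl], rule sum.swap)
  also have "\<dots> = (\<Sum>w\<in>UNIV. \<Sum>x\<in>UNIV. \<Sum>y\<in>UNIV. ev (k + k) w *
      ((ev e (1 - x ^ 2) * \<psi> (w * x)) * (ev f (1 - y ^ 2) * \<psi> (w * r * y))))"
    by (rule sum.swap)
  also have "\<dots> = (\<Sum>w\<in>UNIV. ev (k + k) w * (A e w * A f (w * r)))"
    unfolding A_def sum_product sum_distrib_left[symmetric] ..
  finally have 1: "- G (k + k) * S = (\<Sum>w\<in>UNIV. ev (k + k) w * (A e w * A f (w * r)))" .
  \<comment> \<open>At \<open>w = 0\<close> both sides vanish, so the expansion, obtained from
    \<open>quadratic_fourier\<close> for nonzero \<open>w\<close>, may be summed over all
    \<open>w\<close>.\<close>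
  have A: "((?q - 1) * G (- e)) * ((?q - 1) * G (- f)) * (ev (k + k) w * (A e w * A f (w * r))) =
      ev quad (- 1 :: 'a) * ?q * (\<Sum>m\<in>UNIV. \<Sum>n\<in>UNIV. H e m * H f n * ev (m + n) (1 / 4) * ev n (r ^ 2) *
        ev (k + k + (m + n) + (m + n)) w)" for w
  proof (cases "w = 0")
    case False
    define K where "K e w = (\<Sum>n\<in>UNIV. H e n * ev n (w ^ 2 / 4))" for e w
    have Ae: "(?q - 1) * G (- e) * A e w = G quad * ev quad (- 1 :: 'a) * K e w"
      using quadratic_fourier[OF two assms(2) False] by (simp only: A_def K_def H_def)
    have Af: "(?q - 1) * G (- f) * A f (w * r) = G quad * ev quad (- 1 :: 'a) * K f (w * r)"
    proof -
      have "w * r \<noteq> 0"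
        using False assms(5) by simp
      from quadratic_fourier[OF two assms(3) this] show ?thesis
        by (simp only: A_def K_def H_def)
    qed
    have "((?q - 1) * G (- e)) * ((?q - 1) * G (- f)) * (ev (k + k) w * (A e w * A f (w * r))) =
        ev (k + k) w * (((?q - 1) * G (- e) * A e w) * ((?q - 1) * G (- f) * A f (w * r)))"
      by (simp only: mult_ac)
    also have "\<dots> = (G quad * G quad) * (ev quad (- 1 :: 'a) * ev quad (- 1 :: 'a)) *
        (ev (k + k) w * (K e w * K f (w * r)))"
      unfolding Ae Af by (simp only: mult_ac)
    also have "\<dots> = ev quad (- 1 :: 'a) * ?q * (ev (k + k) w * (K e w * K f (w * r)))"
      unfolding G_quad_sq[OF two] ev_minus_1_sq by simp
    also have "ev (k + k) w * (K e w * K f (w * r)) =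
        (\<Sum>m\<in>UNIV. \<Sum>n\<in>UNIV. H e m * H f n * ev (m + n) (1 / 4) * ev n (r ^ 2) *
        ev (k + k + (m + n) + (m + n)) w)"
    proof -
      have e: "w ^ 2 / 4 = w * w * (1 / 4)" "(w * r) ^ 2 / 4 = w * w * (1 / 4) * r ^ 2"
        by (simp_all add: power2_eq_square)
      show ?thesis
        unfolding K_def sum_product unfolding sum_distrib_left e
        by (rule sum.cong[OF refl], rule sum.cong[OF refl]) (simp only: ev_add ev_mult mult_ac)
    qed
    finally show ?thesis .
  qed simp
  have "((?q - 1) * G (- e)) * ((?q - 1) * G (- f)) * (- G (k + k) * S) =
      ev quad (- 1 :: 'a) * ?q * (\<Sum>w\<in>UNIV. \<Sum>m\<in>UNIV. \<Sum>n\<in>UNIV.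
        H e m * H f n * ev (m + n) (1 / 4) * ev n (r ^ 2) * ev (k + k + (m + n) + (m + n)) w)"
    unfolding 1 sum_distrib_left[of "((?q - 1) * G (- e)) * ((?q - 1) * G (- f))"] A
    unfolding sum_distrib_left ..
  also have "(\<Sum>w\<in>UNIV. \<Sum>m\<in>UNIV. \<Sum>n\<in>UNIV.
        H e m * H f n * ev (m + n) (1 / 4) * ev n (r ^ 2) * ev (k + k + (m + n) + (m + n)) w) =
      (\<Sum>m\<in>UNIV. \<Sum>w\<in>UNIV. \<Sum>n\<in>UNIV.
        H e m * H f n * ev (m + n) (1 / 4) * ev n (r ^ 2) * ev (k + k + (m + n) + (m + n)) w)"
    by (rule sum.swap)
  also have "\<dots> = (\<Sum>m\<in>UNIV. \<Sum>n\<in>UNIV. \<Sum>w\<in>UNIV.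
        H e m * H f n * ev (m + n) (1 / 4) * ev n (r ^ 2) * ev (k + k + (m + n) + (m + n)) w)"
    by (rule sum.cong[OF refl], rule sum.swap)
  also have "\<dots> = (\<Sum>n\<in>UNIV. \<Sum>m\<in>UNIV. \<Sum>w\<in>UNIV.
        H e m * H f n * ev (m + n) (1 / 4) * ev n (r ^ 2) * ev (k + k + (m + n) + (m + n)) w)"
    by (rule sum.swap)
  also have "\<dots> = (\<Sum>n\<in>UNIV. \<Sum>k'\<in>{k, k + quad}. (?q - 1) * ev (k + k) 2 *
      (G (k' + n) * G (quad - e + k' + n) * G (- n) * G (quad - f - n) * ev n (r ^ 2)))"
  proof (rule sum.cong[OF refl])
    fix n
    \<comment> \<open>The two solutions \<open>k + m + n = 0\<close> and
      \<open>k + m + n = quad\<close> are encoded by \<open>m = - k' - n\<close> with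
      \<open>k'\<close> equal to \<open>k\<close> or \<open>k + quad\<close>.\<close>
    have sol: "k + k + (m + n) + (m + n) = 0 \<longleftrightarrow> m \<in> (\<lambda>k'. - k' - n) ` {k, k + quad}" for m
    proof -
      have "k + k + (m + n) + (m + n) = (k + m + n) + (k + m + n)"
        by (simp add: algebra_simps)
      then have "k + k + (m + n) + (m + n) = 0 \<longleftrightarrow> k + m + n = 0 \<or> k + m + n = quad"
        by (simp only: double_eq_0[OF two])
      also have "k + m + n = 0 \<longleftrightarrow> m = - k - n"
        by (auto simp: algebra_simps add_eq_0_iff)
      also have "k + m + n = quad \<longleftrightarrow> m = - (k + quad) - n"
        by (subst uminus_quad[OF two, symmetric]) (auto simp: algebra_simps)
      finally show ?thesis
        by auto
    qed
    have "(\<Sum>w\<in>UNIV. H e m * H f n * ev (m + n) (1 / 4) * ev n (r ^ 2) * ev (k + k + (m + n) + (m + n)) w) =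
        (if m \<in> (\<lambda>k'. - k' - n) ` {k, k + quad} then (?q - 1) *
          (H e m * H f n * ev (m + n) (1 / 4) * ev n (r ^ 2)) else 0)" for m
      unfolding sum_distrib_left[symmetric] sum_ev sol by simp
    then have "(\<Sum>m\<in>UNIV. \<Sum>w\<in>UNIV.
        H e m * H f n * ev (m + n) (1 / 4) * ev n (r ^ 2) * ev (k + k + (m + n) + (m + n)) w) =
        (\<Sum>m\<in>(\<lambda>k'. - k' - n) ` {k, k + quad}. (?q - 1) *
          (H e m * H f n * ev (m + n) (1 / 4) * ev n (r ^ 2)))"
      by (simp only: sum.inter_restrict[OF finite, symmetric] Int_UNIV_left)
    also have "\<dots> = (\<Sum>k'\<in>{k, k + quad}. (?q - 1) *
          (H e (- k' - n) * H f n * ev (- k' - n + n) (1 / 4) * ev n (r ^ 2)))"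
      by (subst sum.reindex) (auto simp: inj_on_def)
    also have "\<dots> = (\<Sum>k'\<in>{k, k + quad}. (?q - 1) * ev (k + k) 2 *
      (G (k' + n) * G (quad - e + k' + n) * G (- n) * G (quad - f - n) * ev n (r ^ 2)))"
    proof (intro sum.cong refl)
      fix k'
      assume k': "k' \<in> {k, k + quad}"
      have "k' + k' = k + k"
        using k' quad_add_quad[OF two] by (auto simp: algebra_simps)
      \<comment> \<open>The values at 1/4 stem from \<open>w ^ 2 / 4\<close>; here they become a
        value at 2 that is the same for both \<open>k'\<close>.\<close>
      moreover have "ev (- k') (1 / 4) = ev (k' + k') 2"
      proof -
        have "ev (- k') (1 / 4 :: 'a) = ev k' (2 * 2)"
          by (simp add: ev_uminus ev_divide inverse_eq_divide)
        then show ?thesis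
          by (simp only: ev_mult ev_add)
      qed
      moreover have "- (- k' - n) = k' + n" "quad - e - (- k' - n) = quad - e + k' + n" "- k' - n + n = - k'"
        by (simp_all add: algebra_simps)
      ultimately show "(?q - 1) * (H e (- k' - n) * H f n * ev (- k' - n + n) (1 / 4) * ev n (r ^ 2)) =
        (?q - 1) * ev (k + k) 2 *
        (G (k' + n) * G (quad - e + k' + n) * G (- n) * G (quad - f - n) * ev n (r ^ 2))"
        unfolding H_def by (simp only: mult_ac)
    qed
    finally show "(\<Sum>m\<in>UNIV. \<Sum>w\<in>UNIV.
        H e m * H f n * ev (m + n) (1 / 4) * ev n (r ^ 2) * ev (k + k + (m + n) + (m + n)) w) =
      (\<Sum>k'\<in>{k, k + quad}. (?q - 1) * ev (k + k) 2 *
      (G (k' + n) * G (quad - e + k' + n) * G (- n) * G (quad - f - n) * ev n (r ^ 2)))" .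
  qed
  also have "\<dots> = (\<Sum>k'\<in>{k, k + quad}. \<Sum>n\<in>UNIV. (?q - 1) * ev (k + k) 2 *
      (G (k' + n) * G (quad - e + k' + n) * G (- n) * G (quad - f - n) * ev n (r ^ 2)))"
    by (rule sum.swap)
  also have "\<dots> = (?q - 1) * ev (k + k) 2 * (\<Sum>k'\<in>{k, k + quad}. barnes_sum k' (quad - e + k') (quad - f) (r ^ 2))"
    unfolding sum_distrib_left[symmetric] barnes_sum_def ..
  finally have *: "((?q - 1) * G (- e)) * ((?q - 1) * G (- f)) * (- G (k + k) * S) =
      ev quad (- 1 :: 'a) * ?q * ((?q - 1) * ev (k + k) 2 *
      (\<Sum>k'\<in>{k, k + quad}. barnes_sum k' (quad - e + k') (quad - f) (r ^ 2)))" .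
  have "- p * (g1 * g2) * K * S = t * u * T"
    if "(p * g1) * (p * g2) * (- K * S) = t * (p * u * T)" "p \<noteq> 0" for p g1 g2 K S t u T :: complex
  proof -
    have "p * (- p * (g1 * g2) * K * S) = p * (t * u * T)"
      using that(1) by (simp add: mult_ac)
    then show ?thesis
      unfolding mult_cancel_left using that(2) by blast
  qed
  from this[OF * q1] show ?thesis
    by (simp only: S_def minus_diff_eq)
qed

text \<open>An instance of \<open>barnes_sum_connection\<close>. Only the double of \<open>k\<close>
  is prescribed, so \<open>c'\<close> may be \<open>c\<close> or \<open>c + quad\<close>, and both
  cases have the lower parameter \<open>c + c\<close>.\<close>

lemma barnes_sum_quad:
  assumes two: "(2 :: 'a) \<noteq> 0" and k: "k + k = a + a + b + b - (c + c)"
    and "k + k \<noteq> 0" "a + a + (b + b) + (c + c) \<noteq> 0" "a + a - (b + b) - (c + c) \<noteq> 0"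
    and c': "c' = a + b - k + quad" and "z \<noteq> 0" "z \<noteq> 1"
  shows "barnes_sum k (quad - (a + a) + k) (quad - (b + b)) z =
    ev quad (- 1 :: 'a) * qq TYPE('a) * (1 - qq TYPE('a)) * ev (c + c) (1 - z) * G (- (c + c)) *
    hypF \<psi> [ev (- a + b + c'), ev (a + b + c' + quad)] [ev (c + c)] (1 - z)"
proof -
  let ?B = "quad - (a + a) + k" and ?D = "quad - (b + b)"
  have qq: "quad + quad = (0 :: 'a mc)"
    by (rule quad_add_quad[OF two])
  have B: "a + b + c' + quad = a + a + (b + b) - k"
  proof -
    have "a + b + c' + quad = a + a + (b + b) - k + (quad + quad)"
      unfolding c' by (simp add: algebra_simps)
    then show ?thesis
      unfolding qq by simp
  qed
  have A': "- k - ?D = - a + b + c'"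
    unfolding c' by (subst uminus_quad[OF two, symmetric]) (simp add: algebra_simps)
  have B': "- ?B - ?D = a + b + c' + quad"
  proof -
    have "- ?B - ?D = a + a + (b + b) - k - (quad + quad)"
      by (simp add: algebra_simps)
    then show ?thesis
      unfolding B qq by simp
  qed
  have D': "k + ?B + ?D = - (c + c)"
  proof -
    have "k + ?B + ?D = (k + k) - (a + a) - (b + b) + (quad + quad)"
      by (simp add: algebra_simps)
    then show ?thesis
      unfolding k qq by (simp add: algebra_simps)
  qed
  \<comment> \<open>Nontriviality is tested on the double, which can be expressed in
    \<open>a\<close>, \<open>b\<close>, \<open>c\<close> alone; \<open>A0\<close> below is shown the
    same way.\<close>
  have B'0: "a + b + c' + quad \<noteq> 0"
  proof
    assume "a + b + c' + quad = 0"
    then have "(a + a + (b + b) - k) + (a + a + (b + b) - k) = 0"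
      unfolding B by simp
    moreover have "(a + a + (b + b) - k) + (a + a + (b + b) - k) =
        (a + a + (b + b)) + (a + a + (b + b)) - (k + k)"
      by (simp add: algebra_simps)
    moreover have "\<dots> = a + a + (b + b) + (c + c)"
      unfolding k by (simp add: algebra_simps)
    ultimately show False
      using assms(4) by simp
  qed
  have k0: "k \<noteq> 0"
    using assms(3) by auto
  have BD: "?B + ?D = - (a + b + c' + quad)"
    unfolding B'[symmetric] by simp
  then have BD0: "?B + ?D \<noteq> 0"
    using B'0 by (metis neg_equal_0_iff_equal)
  have A0: "k + ?D \<noteq> 0"
  proof
    assume "k + ?D = 0"
    then have "(k + ?D) + (k + ?D) = 0"
      by simp
    moreover have "(k + ?D) + (k + ?D) = (k + k) + (quad + quad) - (b + b) - (b + b)"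
      by (simp add: algebra_simps)
    moreover have "\<dots> = a + a - (b + b) - (c + c)"
      unfolding k qq by (simp add: algebra_simps)
    ultimately show False
      using assms(5) by simp
  qed
  have sgn: "ev ?B (- 1) = ev quad (- 1 :: 'a) * ev (a + b + c' + quad) (- 1)"
  proof -
    have "ev k (- 1 :: 'a) = 1 / ev k (- 1)"
      using ev_minus_1_inverse[of k] by (simp add: inverse_eq_divide)
    then show ?thesis
      unfolding B ev_add ev_diff ev_minus_1_sq by simp
  qed
  have T: "barnes_sum k ?B ?D z = ev ?B (- 1) * ev (c + c) (1 - z) * G (- (a + b + c' + quad)) / G (- a + b + c') *
      barnes_sum (- a + b + c') (a + b + c' + quad) (- (c + c)) (1 - z)"
    using barnes_sum_connection[OF k0 BD0 A0 assms(7,8)]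
    unfolding A' B' D' BD by (simp only: minus_minus)
  have F: "hypF \<psi> [ev (- a + b + c'), ev (a + b + c' + quad)] [ev (c + c)] (1 - z) =
      barnes_sum (- a + b + c') (a + b + c' + quad) (- (c + c)) (1 - z) /
      ((1 - qq TYPE('a)) * (G (- a + b + c') * G (a + b + c' + quad) * G (- (c + c))))"
    unfolding hypF_2_1_eq barnes_sum_def ..
  have "G (a + b + c' + quad) * G (- (a + b + c' + quad)) = ev (a + b + c' + quad) (- 1) * qq TYPE('a)"
    using G_reflect B'0 by blast
  then have R: "G (- (a + b + c' + quad)) = ev (a + b + c' + quad) (- 1) * qq TYPE('a) / G (a + b + c' + quad)"
    by (simp add: eq_divide_eq mult_ac)
  have *: "(u * s) * C * (s * q / gB) / gA * T = u * q * (1 - q) * C * gC * (T / ((1 - q) * (gA * gB * gC)))"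
    if "s * s = 1" "q \<noteq> 1" "gC \<noteq> 0" for u s C q gA gB gC T :: complex
  proof -
    have "(1 - q) \<noteq> 0"
      using that by simp
    then have "u * q * (1 - q) * C * gC * (T / ((1 - q) * (gA * gB * gC))) = (u * q * C * T / (gA * gB)) * (s * s)"
      using that by simp
    then show ?thesis
      by (simp add: mult_ac)
  qed
  show ?thesis
    unfolding T F R sgn by (rule * ) (simp_all add: ev_minus_1_sq)
qed

text \<open>Because the lower-row parameters are inverse to the upper ones, the Euler sum contains
  \<open>u * (1 + u * x0)\<close> and \<open>v * (1 + v * y0)\<close> under one character each, and
  completing squares leads to \<open>quadratic_integral\<close>.\<close>

lemma appellF3_quadratic:
  assumes two: "(2 :: 'a) \<noteq> 0" and "a + a \<noteq> 0" "b + b \<noteq> 0"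
    and ab: "a + a + (b + b) \<noteq> c + c" "a + a + (b + b) \<noteq> - (c + c)" "a + a - (b + b) \<noteq> c + c"
    and z: "z \<noteq> 1" "z \<noteq> - 1"
  shows "appellF3 \<psi> (ev (a + a)) (ev (b + b)) (ev (- (a + a))) (ev (- (b + b))) (ev (c + c))
      (z / (z + 1)) (z / (z - 1)) =
    ev (- (b + b + (c + c))) (1 + z) * ev (b + b) (1 - z) *
    (\<Sum>c'\<in>{c, c + quad}. hypF \<psi> [ev (- a + b + c'), ev (a + b + c' + quad)] [ev (c + c)]
      (4 * z / (z + 1) ^ 2))"
proof (cases "z = 0")
  case True
  then show ?thesis
    by (simp add: appellF3_eq hypF_2_1_eq)
next
  case False
  let ?q = "qq TYPE('a)"
  define k where "k = a + b - c"
  define x0 where "x0 = z / (z + 1)"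
  define y0 where "y0 = z / (z - 1)"
  \<comment> \<open>With this \<open>r\<close> the factor \<open>1 + u + v\<close> is proportional
    to \<open>x + r * y\<close> in the new variables, and \<open>1 - r ^ 2\<close> is the argument
    of the resulting 2F1.\<close>
  define r where "r = (1 - z) / (1 + z)"
  define F where "F c' = hypF \<psi> [ev (- a + b + c'), ev (a + b + c' + quad)] [ev (c + c)]
      (4 * z / (z + 1) ^ 2)" for c'
  define S where "S = (\<Sum>(x, y)\<in>UNIV. ev (a + a) (1 - x ^ 2) * ev (b + b) (1 - y ^ 2) *
      ev (- (k + k)) (x + r * y))"
  have four: "(4 :: 'a) \<noteq> 0"
    using two by (metis mult_eq_0_iff mult_2 numeral_Bit0)
  have "z + 1 \<noteq> 0"
    using z(2) by (metis eq_neg_iff_add_eq_0)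
  then have z': "z + 1 \<noteq> 0" "1 + z \<noteq> 0" "z - 1 \<noteq> 0" "1 - z \<noteq> 0"
    using z(1) by (simp_all add: add.commute)
  have xy0: "x0 \<noteq> 0" "y0 \<noteq> 0"
    using False z' by (simp_all add: x0_def y0_def)
  have r: "r \<noteq> 0"
    using z' by (simp add: r_def)
  have r2: "1 - r ^ 2 = 4 * z / (z + 1) ^ 2"
    using z' by (simp add: r_def power2_eq_square divide_simps) (simp add: algebra_simps)
  have r1: "r ^ 2 \<noteq> 1"
    using r2 False four z' by auto
  have kk: "k + k = a + a + (b + b) - (c + c)"
    by (simp add: k_def algebra_simps)
  have k0: "k + k \<noteq> 0"
    using ab(1) unfolding kk by simp
  have "(\<Sum>(u, v)\<in>UNIV. ev (a + a) u * ev (b + b) v * ev (- (k + k)) (1 + u + v) *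
      ev (- (- (a + a))) (1 + u * x0) * ev (- (- (b + b))) (1 + v * y0)) =
      (\<Sum>p\<in>UNIV. ev (- (a + a)) (4 * x0) * ev (- (b + b)) (4 * y0) * ev (- (k + k)) ((z + 1) / (2 * z)) *
        (ev (a + a) (1 - fst p ^ 2) * ev (b + b) (1 - snd p ^ 2) * ev (- (k + k)) (fst p + r * snd p)))"
  proof (rule sum.reindex_bij_witness[where j = "\<lambda>(u, v). (1 + 2 * x0 * u, - 1 - 2 * y0 * v)"
        and i = "\<lambda>(x, y). ((x - 1) / (2 * x0), (- 1 - y) / (2 * y0))"])
    fix p :: "'a \<times> 'a"
    obtain u v where p: "p = (u, v)"
      by (cases p)
    define x where "x = 1 + 2 * x0 * u"
    define y where "y = - 1 - 2 * y0 * v"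
    \<comment> \<open>A doubled character is even, so the signs from completing the squares
      disappear.\<close>
    have sq: "ev (d + d) (- 1 * w) = ev (d + d) w" for d and w :: 'a
      by (simp only: ev_mult ev_add ev_minus_1_sq mult_1_left)
    have "1 - x ^ 2 = - 1 * (4 * x0 * (u * (1 + u * x0)))" "1 - y ^ 2 = - 1 * (4 * y0 * (v * (1 + v * y0)))"
      by (simp_all add: x_def y_def power2_eq_square algebra_simps)
    then have x: "ev (a + a) (1 - x ^ 2) = ev (a + a) (4 * x0) * (ev (a + a) u * ev (a + a) (1 + u * x0))"
      and y: "ev (b + b) (1 - y ^ 2) = ev (b + b) (4 * y0) * (ev (b + b) v * ev (b + b) (1 + v * y0))"
      by (simp_all only: sq) (simp_all only: ev_mult mult.assoc)
    have "(z + 1) * (x + r * y) = (z + 1) * x + (1 - z) * y"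
      using z' by (simp add: r_def distrib_left add.commute)
    also have "\<dots> = (z + 1) + (z + 1) * x0 * (2 * u) - (1 - z) - (1 - z) * y0 * (2 * v)"
      by (simp add: x_def y_def algebra_simps)
    also have "(z + 1) * x0 = z"
      using z' by (simp add: x0_def)
    also have "(1 - z) * y0 = - z"
    proof -
      have "(z - 1) * y0 = z"
        using z' by (simp add: y0_def)
      then show ?thesis
        by (simp add: algebra_simps)
    qed
    finally have "(z + 1) * (x + r * y) = (1 + u + v) * (2 * z)"
      by (simp add: algebra_simps)
    then have "1 + u + v = (z + 1) * (x + r * y) / (2 * z)"
      using False two by (simp add: eq_divide_eq)
    then have w: "1 + u + v = (z + 1) / (2 * z) * (x + r * y)"
      by simp
    have xy1: "ev (a + a) (4 * x0) \<noteq> 0" "ev (b + b) (4 * y0) \<noteq> 0"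
      using xy0 four by simp_all
    have "ev (- (a + a)) (4 * x0) * ev (- (b + b)) (4 * y0) * ev (- (k + k)) ((z + 1) / (2 * z)) *
        (ev (a + a) (1 - x ^ 2) * ev (b + b) (1 - y ^ 2) * ev (- (k + k)) (x + r * y)) =
        ev (a + a) u * ev (b + b) v * ev (- (k + k)) (1 + u + v) *
        ev (- (- (a + a))) (1 + u * x0) * ev (- (- (b + b))) (1 + v * y0)"
      unfolding x y w ev_mult[of _ "(z + 1) / (2 * z)"] ev_uminus[of _ "4 * _"] minus_minus
      using xy1 by (simp only: mult_ac) (simp add: divide_simps)
    then show "ev (- (a + a)) (4 * x0) * ev (- (b + b)) (4 * y0) * ev (- (k + k)) ((z + 1) / (2 * z)) *
        (ev (a + a) (1 - fst (case p of (u, v) \<Rightarrow> (1 + 2 * x0 * u, - 1 - 2 * y0 * v)) ^ 2) *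
         ev (b + b) (1 - snd (case p of (u, v) \<Rightarrow> (1 + 2 * x0 * u, - 1 - 2 * y0 * v)) ^ 2) *
         ev (- (k + k)) (fst (case p of (u, v) \<Rightarrow> (1 + 2 * x0 * u, - 1 - 2 * y0 * v)) +
           r * snd (case p of (u, v) \<Rightarrow> (1 + 2 * x0 * u, - 1 - 2 * y0 * v)))) =
        (case p of (u, v) \<Rightarrow> ev (a + a) u * ev (b + b) v * ev (- (k + k)) (1 + u + v) *
        ev (- (- (a + a))) (1 + u * x0) * ev (- (- (b + b))) (1 + v * y0))"
      by (simp only: p prod.case fst_conv snd_conv x_def y_def)
  qed (use xy0 two in \<open>auto simp: field_simps\<close>)
  also have "\<dots> = ev (- (a + a)) (4 * x0) * ev (- (b + b)) (4 * y0) * ev (- (k + k)) ((z + 1) / (2 * z)) * S"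
    unfolding S_def by (simp add: sum_distrib_left case_prod_beta)
  finally have int: "(\<Sum>(u, v)\<in>UNIV. ev (a + a) u * ev (b + b) v * ev (- (k + k)) (1 + u + v) *
      ev (- (- (a + a))) (1 + u * x0) * ev (- (- (b + b))) (1 + v * y0)) =
      ev (- (a + a)) (4 * x0) * ev (- (b + b)) (4 * y0) * ev (- (k + k)) ((z + 1) / (2 * z)) * S" .
  have appell: "appellF3 \<psi> (ev (a + a)) (ev (b + b)) (ev (- (a + a))) (ev (- (b + b))) (ev (c + c)) x0 y0 =
      G (k + k) / (G (a + a) * G (b + b) * G (- (c + c))) *
      (ev (- (a + a)) (4 * x0) * ev (- (b + b)) (4 * y0) * ev (- (k + k)) ((z + 1) / (2 * z)) * S)"
    unfolding int[symmetric] unfolding kk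
  proof (rule appellF3_integral)
    show "a + a + (b + b) - (c + c) \<noteq> 0"
      using k0 unfolding kk .
    show "- (a + a) \<noteq> 0" "- (b + b) \<noteq> 0"
      using assms(2,3) by (simp_all only: neg_equal_0_iff_equal not_False_eq_True)
  qed (use xy0 in simp_all)
  have F: "barnes_sum k' (quad - (a + a) + k') (quad - (b + b)) (r ^ 2) =
      ev quad (- 1 :: 'a) * ?q * (1 - ?q) * ev (c + c) (1 - r ^ 2) * G (- (c + c)) * F (a + b - k' + quad)"
    if "k' + k' = k + k" for k'
    unfolding F_def r2[symmetric]
  proof (rule barnes_sum_quad[OF two])
    show "k' + k' = a + a + b + b - (c + c)"
      using that kk by (simp only: add.assoc)
    show "k' + k' \<noteq> 0"
      using that k0 by simp
    show "a + a + (b + b) + (c + c) \<noteq> 0"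
      using ab(2) unfolding eq_neg_iff_add_eq_0 .
    show "a + a - (b + b) - (c + c) \<noteq> 0"
      using ab(3) by (simp only: right_minus_eq not_False_eq_True)
  qed (use r r1 in simp_all)
  have qq: "quad + quad = (0 :: 'a mc)"
    by (rule quad_add_quad[OF two])
  \<comment> \<open>The passage from \<open>k'\<close> to \<open>c'\<close> interchanges the two
    terms of the sum.\<close>
  have c': "a + b - k + quad = c + quad" "a + b - (k + quad) + quad = c"
    by (simp_all add: k_def)
  have kq: "(k + quad) + (k + quad) = k + k"
  proof -
    have "(k + quad) + (k + quad) = k + k + (quad + quad)"
      by (simp add: algebra_simps)
    then show ?thesis
      unfolding qq by simp
  qed
  have kne: "k \<noteq> k + quad" and cne: "c \<noteq> c + quad"
    using quad_nonzero[OF two] by simp_all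
  have sumF: "(\<Sum>k'\<in>{k, k + quad}. barnes_sum k' (quad - (a + a) + k') (quad - (b + b)) (r ^ 2)) =
      ev quad (- 1 :: 'a) * ?q * (1 - ?q) * ev (c + c) (1 - r ^ 2) * G (- (c + c)) * (\<Sum>c'\<in>{c, c + quad}. F c')"
    (is "?L = ?C * _")
  proof -
    have "?L = barnes_sum k (quad - (a + a) + k) (quad - (b + b)) (r ^ 2) +
        barnes_sum (k + quad) (quad - (a + a) + (k + quad)) (quad - (b + b)) (r ^ 2)"
      using kne by simp
    also have "\<dots> = ?C * F (c + quad) + ?C * F c"
      unfolding F[OF refl] F[OF kq] c' ..
    also have "\<dots> = ?C * (F c + F (c + quad))"
      by (simp only: distrib_left add.commute)
    also have "F c + F (c + quad) = (\<Sum>c'\<in>{c, c + quad}. F c')"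
      using cne by simp
    finally show ?thesis .
  qed
  have main: "(1 - ?q) * (G (- (a + a)) * G (- (b + b))) * G (k + k) * S =
      ev quad (- 1 :: 'a) * ?q * ev (k + k) 2 *
      (ev quad (- 1 :: 'a) * ?q * (1 - ?q) * ev (c + c) (1 - r ^ 2) * G (- (c + c)) * (\<Sum>c'\<in>{c, c + quad}. F c'))"
    unfolding sumF[symmetric] S_def by (rule quadratic_integral) (use assms k0 r in auto)
  have refl: "G (- (d + d)) = ?q / G (d + d)" if "d + d \<noteq> 0" for d
  proof -
    have "G (d + d) * G (- (d + d)) = ?q"
      using G_reflect[OF that] by (simp only: ev_add ev_minus_1_sq mult_1_left)
    then show ?thesis
      by (simp add: eq_divide_eq mult_ac)
  qed
  \<comment> \<open>Doubled characters have sign 1 in the reflection formula, and the two factors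
    \<open>ev quad (- 1)\<close>, one from each lemma, cancel.\<close>
  have GS: "G (k + k) * S / (G (a + a) * G (b + b) * G (- (c + c))) =
      ev (k + k) 2 * ev (c + c) (1 - r ^ 2) * (\<Sum>c'\<in>{c, c + quad}. F c')"
  proof -
    have "K * S / (g1 * g2 * g) = k2 * C * T"
      if "(1 - q) * (q / g1 * (q / g2)) * K * S = s * q * k2 * (s * q * (1 - q) * C * g * T)"
        "s * s = 1" "1 - q \<noteq> 0" "q \<noteq> 0" "g1 \<noteq> 0" "g2 \<noteq> 0" "g \<noteq> 0"
      for K S g1 g2 g k2 C T q s :: complex
    proof -
      have "((1 - q) * q * q) * (K * S / (g1 * g2)) = ((1 - q) * q * q) * ((s * s) * (k2 * C * g * T))"
        using that(1) by (simp add: mult_ac)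
      moreover have "(1 - q) * q * q \<noteq> 0"
        using that(3,4) by (simp only: mult_eq_0_iff) simp
      ultimately have "K * S / (g1 * g2) = k2 * C * g * T"
        unfolding mult_cancel_left using that(2) by simp
      then have "K * S / (g1 * g2) / g = k2 * C * T"
        using that by simp
      then show ?thesis
        by simp
    qed
    from this[OF main[unfolded refl[OF assms(2)] refl[OF assms(3)]]] show ?thesis
      by (simp add: ev_minus_1_sq)
  qed
  have "ev (- (a + a)) (4 * x0) * ev (- (b + b)) (4 * y0) * ev (- (k + k)) ((z + 1) / (2 * z)) *
      (ev (k + k) 2 * ev (c + c) (1 - r ^ 2)) =
      ev (- (b + b + (c + c))) (1 + z) * ev (b + b) (1 - z)"
  proof -
    have f: "(4 :: 'a) = 2 * 2"
      by simp
    have "ev (b + b) (z - 1) = ev (b + b) (- 1 * (1 - z))"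
      by simp
    then have zb: "ev (b + b) (z - 1) = ev (b + b) (1 - z)"
      by (simp only: ev_mult ev_add ev_minus_1_sq mult_1_left)
    have nz: "ev d (1 + z) \<noteq> 0" "ev d (1 - z) \<noteq> 0" "ev d z \<noteq> 0" "ev d (2 :: 'a) \<noteq> 0" for d
      using z' False two by simp_all
    have y: "ev (- (b + b)) (4 * y0) = ev (b + b) (1 - z) / (ev (b + b) z * (ev (b + b) 2 * ev (b + b) 2))"
      unfolding y0_def f ev_uminus ev_mult ev_divide zb by (simp add: divide_simps)
    show ?thesis
      unfolding r2 y
      unfolding x0_def f ev_uminus ev_mult ev_divide kk power2_eq_square add.commute[of z 1]
      unfolding ev_diff ev_add using nz by (simp add: field_simps)
  qed
  then have "ev (- (a + a)) (4 * x0) * ev (- (b + b)) (4 * y0) * ev (- (k + k)) ((z + 1) / (2 * z)) *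
      (G (k + k) * S / (G (a + a) * G (b + b) * G (- (c + c)))) =
      ev (- (b + b + (c + c))) (1 + z) * ev (b + b) (1 - z) * (\<Sum>c'\<in>{c, c + quad}. F c')"
    unfolding GS by (simp only: mult.assoc[symmetric])
  then show ?thesis
    unfolding x0_def[symmetric] y0_def[symmetric] appell F_def by (simp only: times_divide_eq_left times_divide_eq_right mult_ac)
qed

end

section \<open>Return to characters as functions\<close>

theorem theorem3p14:
  fixes \<psi> :: "'a::{finite,field} \<Rightarrow> complex"
    and a1 a2 b1 b2 c :: "'a \<Rightarrow> complex"
  assumes psi: "addchar \<psi>" "\<psi> \<noteq> (\<lambda>_. 1)"
    and chars: "a1 \<in> mchars" "a2 \<in> mchars" "b1 \<in> mchars" "b2 \<in> mchars" "c \<in> mchars"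
  shows
   "(eps \<notin> {a1, a2, b2, cmul (cinv (cmul b1 b2)) c} \<longrightarrow>
      (\<forall>lam::'a. appellF3 \<psi> a1 a2 b1 b2 c lam 1 =
         gauss0 \<psi> c * gauss \<psi> (cmul (cinv (cmul a2 b2)) c) /
           (gauss0 \<psi> (cmul (cinv a2) c) * gauss0 \<psi> (cmul (cinv b2) c)) *
         hypF \<psi> [a1, b1, cmul (cinv (cmul a2 b2)) c] [cmul (cinv a2) c, cmul (cinv b2) c] lam))
  \<and> (eps \<notin> {a1, a2, b1, b2, cmul (cinv (cmul a1 a2)) c} \<longrightarrow>
      (\<forall>lam::'a. lam \<noteq> 1 \<longrightarrow>
         appellF3 \<psi> a1 a2 b1 b2 c lam (lam / (lam - 1)) =
         gauss \<psi> (cmul (cmul a1 a2) (cinv c)) * gauss \<psi> (cmul (cmul a2 b1) (cinv c)) *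
           gauss \<psi> (cinv b2) /
           (gauss \<psi> (cinv c) * gauss0 \<psi> (cmul (cmul (cmul a1 a2) b1) (cinv c)) *
             gauss0 \<psi> (cmul a2 (cinv b2))) *
         cinv c lam * a2 (1 - lam) *
         hypF \<psi> [cmul (cmul a1 a2) (cinv c), cmul (cmul a2 b1) (cinv c), cinv b2]
                [cmul (cmul (cmul a1 a2) b1) (cinv c), cmul a2 (cinv b2)] (1 - lam)))
  \<and> ((2::'a) \<noteq> 0 \<and> eps \<notin> {cmul b1 b1, cmul b2 b2} \<and>
      cmul (cmul b1 b2) (cmul b1 b2) \<notin> {cmul c c, cmul (cinv c) (cinv c)} \<and>
      cmul (cmul b1 (cinv b2)) (cmul b1 (cinv b2)) \<notin> {cmul c c, cmul (cinv c) (cinv c)} \<longrightarrow>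
      (\<forall>lam::'a. lam \<noteq> 1 \<and> lam \<noteq> -1 \<longrightarrow>
         appellF3 \<psi> (cmul b1 b1) (cmul b2 b2) (cmul (cinv b1) (cinv b1)) (cmul (cinv b2) (cinv b2))
           (cmul c c) (lam / (lam + 1)) (lam / (lam - 1)) =
         cinv (cmul (cmul b2 b2) (cmul c c)) (1 + lam) * cmul b2 b2 (1 - lam) *
         (\<Sum>c' \<in> {c, cmul c qchar}.
            hypF \<psi> [cmul (cmul (cinv b1) b2) c', cmul (cmul (cmul b1 b2) c') qchar] [cmul c c]
              (4 * lam / (lam + 1)^2))))"
proof -
  interpret nontrivial_addchar \<psi>
    using psi by unfold_locales
  obtain A1 A2 B1 B2 C where ch: "a1 = ev A1" "a2 = ev A2" "b1 = ev B1" "b2 = ev B2" "c = ev C"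
    using chars unfolding mchars_eq by blast
  \<comment> \<open>Folds \<open>cmul\<close>, \<open>cinv\<close> and \<open>eps\<close> into the
    additive operations, so that the goals match the lemmas on \<open>ev\<close>.\<close>
  note reps = plus_mc.rep_eq[symmetric] uminus_mc.rep_eq[symmetric] zero_mc.rep_eq[symmetric]
  have ne: "x \<noteq> y" if "ev x \<noteq> ev y" for x y :: "'a mc"
    using that by blast
  show ?thesis
  proof (intro conjI impI allI)
    fix lam :: 'a
    assume "eps \<notin> {a1, a2, b2, cmul (cinv (cmul b1 b2)) c}"
    then have "A2 \<noteq> 0" "B2 \<noteq> 0"
      unfolding ch reps by auto
    from appellF3_at_1[OF this]
    show "appellF3 \<psi> a1 a2 b1 b2 c lam 1 =
         gauss0 \<psi> c * gauss \<psi> (cmul (cinv (cmul a2 b2)) c) /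
           (gauss0 \<psi> (cmul (cinv a2) c) * gauss0 \<psi> (cmul (cinv b2) c)) *
         hypF \<psi> [a1, b1, cmul (cinv (cmul a2 b2)) c] [cmul (cinv a2) c, cmul (cinv b2) c] lam"
      unfolding ch reps .
  next
    fix lam :: 'a
    assume *: "eps \<notin> {a1, a2, b1, b2, cmul (cinv (cmul a1 a2)) c}" and lam: "lam \<noteq> 1"
    have "- (A1 + A2) + C \<noteq> 0"
      using * unfolding ch reps by auto
    then have "A1 + A2 - C \<noteq> 0"
      by (metis add.commute add_uminus_conv_diff eq_iff_diff_eq_0)
    moreover have "A1 \<noteq> 0" "A2 \<noteq> 0" "B1 \<noteq> 0" "B2 \<noteq> 0"
      using * unfolding ch reps by auto
    ultimately show "appellF3 \<psi> a1 a2 b1 b2 c lam (lam / (lam - 1)) =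
         gauss \<psi> (cmul (cmul a1 a2) (cinv c)) * gauss \<psi> (cmul (cmul a2 b1) (cinv c)) *
           gauss \<psi> (cinv b2) /
           (gauss \<psi> (cinv c) * gauss0 \<psi> (cmul (cmul (cmul a1 a2) b1) (cinv c)) *
             gauss0 \<psi> (cmul a2 (cinv b2))) *
         cinv c lam * a2 (1 - lam) *
         hypF \<psi> [cmul (cmul a1 a2) (cinv c), cmul (cmul a2 b1) (cinv c), cinv b2]
                [cmul (cmul (cmul a1 a2) b1) (cinv c), cmul a2 (cinv b2)] (1 - lam)"
      unfolding ch reps add_uminus_conv_diff using appellF3_line[of B1 B2 A1 A2 C lam] lam by blast
  next
    fix lam :: 'a
    assume *: "(2::'a) \<noteq> 0 \<and> eps \<notin> {cmul b1 b1, cmul b2 b2} \<and>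
      cmul (cmul b1 b2) (cmul b1 b2) \<notin> {cmul c c, cmul (cinv c) (cinv c)} \<and>
      cmul (cmul b1 (cinv b2)) (cmul b1 (cinv b2)) \<notin> {cmul c c, cmul (cinv c) (cinv c)}"
      and lam: "lam \<noteq> 1 \<and> lam \<noteq> - 1"
    have two: "(2 :: 'a) \<noteq> 0"
      using * by blast
    have quad: "qchar = ev (quad :: 'a mc)"
      using ev_quad[OF two] by auto
    have "ev (B1 + B1) \<noteq> ev 0" "ev (B2 + B2) \<noteq> ev 0"
      "ev (B1 + B2 + (B1 + B2)) \<noteq> ev (C + C)" "ev (B1 + B2 + (B1 + B2)) \<noteq> ev (- C + - C)"
      "ev (B1 + - B2 + (B1 + - B2)) \<noteq> ev (C + C)"
      using * unfolding ch reps by auto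
    note this[THEN ne]
    moreover have "B1 + B2 + (B1 + B2) = B1 + B1 + (B2 + B2)" "- C + - C = - (C + C)"
      "B1 + - B2 + (B1 + - B2) = B1 + B1 - (B2 + B2)"
      "- B1 + - B1 = - (B1 + B1)" "- B2 + - B2 = - (B2 + B2)"
      by (simp_all add: algebra_simps)
    moreover have "(\<Sum>c'\<in>{ev C, ev (C + quad)}. hypF \<psi> [cmul (cmul (cinv (ev B1)) (ev B2)) c',
          cmul (cmul (cmul (ev B1) (ev B2)) c') (ev quad)] [ev (C + C)] (4 * lam / (lam + 1)\<^sup>2)) =
        (\<Sum>c'\<in>{C, C + quad}. hypF \<psi> [ev (- B1 + B2 + c'), ev (B1 + B2 + c' + quad)] [ev (C + C)]
          (4 * lam / (lam + 1)\<^sup>2))"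
      \<comment> \<open>Since \<open>quad\<close> is nontrivial and \<open>ev\<close> injective,
        both index sets have two distinct elements and the sums agree term by term.\<close>
      using quad_nonzero[OF two] by (simp add: ev_inject reps)
    ultimately show "appellF3 \<psi> (cmul b1 b1) (cmul b2 b2) (cmul (cinv b1) (cinv b1)) (cmul (cinv b2) (cinv b2))
           (cmul c c) (lam / (lam + 1)) (lam / (lam - 1)) =
         cinv (cmul (cmul b2 b2) (cmul c c)) (1 + lam) * cmul b2 b2 (1 - lam) *
         (\<Sum>c' \<in> {c, cmul c qchar}.
            hypF \<psi> [cmul (cmul (cinv b1) b2) c', cmul (cmul (cmul b1 b2) c') qchar] [cmul c c]
              (4 * lam / (lam + 1)^2))"
      unfolding quad ch reps using appellF3_quadratic[OF two, of B1 B2 C lam] lam by metis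
  qed
qed


end
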